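(* Let $d=1$, $\alpha\in(0,2]$, $t>0$, $x\in\mathbb R$. For $\varepsilon,\delta>0$ let $I^{\varepsilon,\delta}_{t,x}:=W(A^{\varepsilon,\delta}_{t,x})$. Then $I^{\varepsilon,\delta}_{t,x}$ converges in $L^2(\Omega)$ (with respect to the joint law of $W$ and $X$) as $(\varepsilon,\delta)\to 0$ to a limit $I_{t,x}$, denoted $I_{t,x}=\int_0^t\int_{\mathbb R}\delta(X^x_{t-r}-y)\,W(dr,dy)$. Moreover, conditionally on $X$, $I_{t,x}$ is a centered Gaussian random variable with variance $$\mathrm{Var}[I_{t,x}\mid X]=\int_0^t\int_0^t p_{|s-r|}(X_s-X_r)\,dr\,ds.$$
   Context: $p_t(x)=(2\pi t)^{-d/2}\exp(-|x|^2/(2t))$ is the heat kernel on $\mathbb R^d$. $X=\{X_t\}_{t\ge0}$ is a $d$-dimensional $\alpha$-stable process ($\alpha\in(0,2]$) started at $0$, whose density $g_\alpha(t,\cdot)$ has Fourier transform $\exp(-c_\alpha t|\xi|^\alpha)$ for some $c_\alpha>0$; $X^x_s:=X_s+x$. $\mathcal H$ is the completion of $C_c^\infty([0,\infty)\times\mathbb R^d)$ under the inner product $\langle f,g\rangle_{\mathcal H}=\int_{\mathbb R_+^2\times\mathbb R^{2d}} f(s,x)g(t,y)p_{|t-s|}(x-y)\,dx\,dy\,ds\,dt$, and $\{W(g),g\in\mathcal H\}$ is an isonormal Gaussian process with $\mathbb E[W(g)W(h)]=\langle g,h\rangle_{\mathcal H}$ (so formally $\mathbb E[\dot W(t,x)\dot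 W(s,y)]=p_{|t-s|}(x-y)$), independent of $X$. Let $\psi_\delta(t)=\delta^{-1}\mathbf 1_{[0,\delta]}(t)$ and $A^{\varepsilon,\delta}_{t,x}(r,y)=\int_0^t\psi_\delta(t-s-r)\,p_\varepsilon(X^x_s-y)\,ds$; conditionally on $X$, $A^{\varepsilon,\delta}_{t,x}\in\mathcal H$ a.s., so $W(A^{\varepsilon,\delta}_{t,x})$ is well defined. *)

theory Defs
  imports "HOL-Probability.Probability"
begin

definition heat :: "real \<Rightarrow> real \<Rightarrow> real" where
  "heat t z = (2 * pi * t) powr (-1/2) * exp (- (z^2) / (2 * t))"

definition psi :: "real \<Rightarrow> real \<Rightarrow> real" where
  "psi \<delta> u = indicator {0..\<delta>} u / \<delta>"

definition H_kernel :: "(real \<Rightarrow> real \<Rightarrow> real) \<Rightarrow> (real \<Rightarrow> real \<Rightarrow> real)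
    \<Rightarrow> (real \<times> real) \<times> (real \<times> real) \<Rightarrow> real" where
  "H_kernel f g = (\<lambda>((s,u),(r,v)). indicator {0..} s * indicator {0..} r
       * f s u * g r v * heat \<bar>r - s\<bar> (u - v))"

text \<open>Functions (time, space) \<mapsto> real that are (represent) elements of H:
  measurable with absolutely convergent H-norm integral.\<close>
definition H_admissible :: "(real \<Rightarrow> real \<Rightarrow> real) \<Rightarrow> bool" where
  "H_admissible f \<longleftrightarrow> (\<lambda>(s,u). f s u) \<in> borel_measurable lborel
     \<and> integrable lborel (H_kernel (\<lambda>s u. \<bar>f s u\<bar>) (\<lambda>s u. \<bar>f s u\<bar>))"

definition H_inner :: "(real \<Rightarrow> real \<Rightarrow> real) \<Rightarrow> (real \<Rightarrow> real \<Rightarrow> real) \<Rightarrow> real" where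
  "H_inner f g = integral\<^sup>L lborel (H_kernel f g)"

text \<open>Isonormal Gaussian process W on H over the probability space MW:
  W is linear (a.s.) and each W(f) is centered Gaussian with variance <f,f>_H
  (expressed through its characteristic function, which also covers the degenerate case).\<close>
definition isonormal :: "'w measure \<Rightarrow> ((real \<Rightarrow> real \<Rightarrow> real) \<Rightarrow> 'w \<Rightarrow> real) \<Rightarrow> bool" where
  "isonormal MW W \<longleftrightarrow> prob_space MW
     \<and> (\<forall>f. H_admissible f \<longrightarrow> W f \<in> borel_measurable MW
          \<and> (\<forall>\<theta>. char (distr MW borel (W f)) \<theta>
                  = complex_of_real (exp (- (\<theta>^2 * H_inner f f) / 2))))
     \<and> (\<forall>f g a b. H_admissible f \<longrightarrow> H_admissible g \<longrightarrow>
          (AE w in MW. W (\<lambda>r y. a * f r y + b * g r y) w = a * W f w + b * W g w))"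

definition stable_process :: "'x measure \<Rightarrow> real \<Rightarrow> real \<Rightarrow> (real \<Rightarrow> 'x \<Rightarrow> real) \<Rightarrow> bool" where
  "stable_process MX \<alpha> c X \<longleftrightarrow> prob_space MX
     \<and> (\<forall>s. X s \<in> borel_measurable MX)
     \<and> (\<forall>\<xi>\<in>space MX. X 0 \<xi> = 0
          \<and> (\<forall>s\<ge>0. continuous (at_right s) (\<lambda>u. X u \<xi>))
          \<and> (\<forall>s>0. \<exists>l. ((\<lambda>u. X u \<xi>) \<longlongrightarrow> l) (at_left s)))
     \<and> (\<forall>s u. 0 \<le> s \<longrightarrow> s < u \<longrightarrow> (\<forall>\<theta>.
          char (distr MX borel (\<lambda>\<xi>. X u \<xi> - X s \<xi>)) \<theta>
            = complex_of_real (exp (- c * (u - s) * \<bar>\<theta>\<bar> powr \<alpha>))))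
     \<and> (\<forall>(ts :: nat \<Rightarrow> real) n. 0 \<le> ts 0 \<longrightarrow> strict_mono ts \<longrightarrow>
          prob_space.indep_vars MX (\<lambda>_. borel) (\<lambda>i \<xi>. X (ts (Suc i)) \<xi> - X (ts i) \<xi>) {..<n})"

definition A_fun :: "real \<Rightarrow> real \<Rightarrow> real \<Rightarrow> real \<Rightarrow> (real \<Rightarrow> 'x \<Rightarrow> real) \<Rightarrow> 'x
    \<Rightarrow> real \<Rightarrow> real \<Rightarrow> real" where
  "A_fun \<epsilon> \<delta> t x X \<xi> = (\<lambda>r y. LINT s:{0..t}|lborel. psi \<delta> (t - s - r) * heat \<epsilon> (X s \<xi> + x - y))"

end

theory Submission
  imports Defs
begin

text \<open>
  For \<open>d = 1\<close> the convergence is deterministic: it holds for every fixed path. By the semigroup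
  property of the heat kernel, the inner product of two smeared paths is the double integral over
  \<open>[0,t]\<^sup>2\<close> of an average of \<open>p_{\<epsilon> + \<epsilon>' + |r - r'|}(X_s - X_{s'})\<close> over \<open>r, r'\<close> within
  \<open>\<delta>, \<delta>'\<close> of \<open>t - s\<close> and \<open>t - s'\<close>. Since \<open>p_u \<le> u\<^bsup>-1/2\<^esup>\<close>, and averaging \<open>|v|\<^bsup>-1/2\<^esup>\<close> over any
  interval ending at \<open>v\<close> increases it by at most a constant factor, the integrand is dominated by a
  multiple of the integrable function \<open>|s - s'|\<^bsup>-1/2\<^esup>\<close>, so all these inner products converge to
  the same limit, the claimed variance, and the smeared paths are Cauchy in the Hilbert space.

  \<open>W\<close> is only given pointwise on functions, so \<open>(w, \<xi>) \<mapsto> W (A \<xi>) w\<close> need not be jointly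
  measurable. A measurable limit is therefore built from smeared rounded step paths, which range over
  a countable set of paths and converge to \<open>X\<close> by right-continuity; a rapidly converging
  subsequence converges almost surely for almost every path.
\<close>

section \<open>The heat kernel and the singularity of inverse square root type\<close>

text \<open>Dimension one enters through the exponent: the heat kernel at distance 0 blows up in
  time with exponent half the dimension, and only 1/2 leaves a singularity in \<open>s - s'\<close>
  that is integrable uniformly in all four widths. Every comparison of smeared paths goes through
  energies of two possibly different paths, so that one set of estimates serves both for the Cauchy
  property of the step approximations and for their distance to the true path. These energies are
  measurable functions of the sample point even where the random variables built from the true path
  are not known to be, so means over the path law are taken of energies, and the actual distances
  enter such means only through monotonicity. Dominated convergence speaks of sequences; limits in
  several parameters are therefore tested along arbitrary sequences.\<close>

lemma heat_nonneg [simp]: "0 \<le> heat u z"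
  by (simp add: heat_def)

lemma borel_measurable_heat [measurable (raw)]:
  assumes [measurable]: "f \<in> borel_measurable M" "g \<in> borel_measurable M"
  shows "(\<lambda>x. heat (f x) (g x)) \<in> borel_measurable M"
  unfolding heat_def by measurable

lemma heat_normal_density:
  assumes "0 < u" shows "heat u z = normal_density 0 (sqrt u) z"
  using assms by (simp add: heat_def normal_density_def powr_minus powr_half_sqrt field_simps)

lemma heat_minus: "heat u (- z) = heat u z"
  by (simp add: heat_def)

text \<open>Translating \<open>y\<close> by \<open>b\<close> turns the integral into the convolution
  of two centred normal densities, whose variances \<open>u\<close> and \<open>v\<close>
  add.\<close>

lemma heat_semigroup:
  assumes "0 < u" "0 < v"
  shows "(\<integral>\<^sup>+ y. ennreal (heat u (a - y)) * ennreal (heat v (y - b)) \<partial>lborel) = ennreal (heat (u + v) (a - b))"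
proof -
  have "(\<integral>\<^sup>+ y. ennreal (heat u (a - y)) * ennreal (heat v (y - b)) \<partial>lborel)
      = (\<integral>\<^sup>+ y. ennreal (heat u (a - (b + y))) * ennreal (heat v (b + y - b)) \<partial>lborel)"
    using nn_integral_real_affine[of "\<lambda>y. ennreal (heat u (a - y)) * ennreal (heat v (y - b))" 1 b] by simp
  also have "\<dots> = (\<integral>\<^sup>+ y. ennreal (normal_density 0 (sqrt u) ((a - b) - y) * normal_density 0 (sqrt v) y) \<partial>lborel)"
    using assms by (simp add: heat_normal_density ennreal_mult algebra_simps)
  also have "\<dots> = ennreal (heat (u + v) (a - b))"
    using fun_cong[OF conv_normal_density_zero_mean[of "sqrt u" "sqrt v"], of "a - b"] assms
    by (simp add: heat_normal_density)
  finally show ?thesis .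
qed

text \<open>Dropping the exponential gives a bound free of \<open>z\<close>, which is why the shape
  of the paths never enters the estimates. The factor \<open>2 * pi\<close> exceeds 1 and is
  discarded.\<close>

lemma heat_le_inverse_sqrt:
  assumes "0 \<le> u"
  shows "heat u z \<le> 1 / sqrt u"
proof (cases "u = 0")
  \<comment> \<open>Both sides vanish, since \<open>0 powr a\<close> and division by 0 both give 0.
    In particular \<open>heat 0 z = 0\<close>: equal times carry no infinite value.\<close>
  case True then show ?thesis by (simp add: heat_def)
next
  case False
  then have u: "0 < u" using assms by simp
  have "heat u z \<le> (2 * pi * u) powr (-1/2)"
    using u by (simp add: heat_def mult_left_le)
  also have "\<dots> = 1 / sqrt (2 * pi * u)"
    using u by (simp add: powr_minus powr_half_sqrt field_simps)
  also have "\<dots> \<le> 1 / sqrt u"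
  proof -
    have "1 * u \<le> (2 * pi) * u" using u pi_gt3 by (intro mult_right_mono) auto
    then show ?thesis using u by (intro divide_left_mono) (auto simp del: real_sqrt_mult)
  qed
  finally show ?thesis .
qed

lemma tendsto_heat:
  assumes "(f \<longlongrightarrow> u) F" "(g \<longlongrightarrow> z) F" "0 < u"
  shows "((\<lambda>x. heat (f x) (g x)) \<longlongrightarrow> heat u z) F"
  unfolding heat_def using assms by (intro tendsto_intros) auto

text \<open>\<open>G\<close> is an antiderivative of the inverse square root of \<bar>u\<bar> on
  both sides of 0 and is continuous at 0. Averaging over the interval from \<open>v - d\<close> to
  \<open>v\<close> thus costs only boundary values, even with the singularity inside.\<close>

lemma nn_integral_inverse_sqrt:
  assumes d: "0 < d"
  defines "G \<equiv> \<lambda>u::real. 2 * sgn u * sqrt \<bar>u\<bar>"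
  shows "(\<integral>\<^sup>+ h. ennreal (indicator {0..1} h / sqrt \<bar>v - d * h\<bar>) \<partial>lborel) = ennreal ((G v - G (v - d)) / d)"
proof -
  define F where "F = (\<lambda>h. - G (v - d * h) / d)"
  have contG: "continuous_on UNIV G"
  proof -
    have "G = (\<lambda>u. if 0 \<le> u then 2 * sqrt u else - 2 * sqrt (-u))"
      by (auto simp: G_def fun_eq_iff sgn_if)
    moreover have "continuous_on UNIV (\<lambda>u::real. if 0 \<le> u then 2 * sqrt u else - 2 * sqrt (-u))"
    proof -
      have "continuous_on ({u. 0 \<le> u} \<union> {u. u \<le> 0}) (\<lambda>u::real. if 0 \<le> u then 2 * sqrt u else - 2 * sqrt (-u))"
        by (intro continuous_on_If continuous_intros closed_Collect_le) auto
      moreover have "{u::real. 0 \<le> u} \<union> {u. u \<le> 0} = UNIV" by auto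
      ultimately show ?thesis by simp
    qed
    ultimately show ?thesis by simp
  qed
  have contF: "continuous_on {0..1} F"
    unfolding F_def using d
    by (intro continuous_intros continuous_on_compose2[OF contG]) auto
  have der: "(F has_vector_derivative (1 / sqrt \<bar>v - d * h\<bar>)) (at h)" if "h \<in> {0<..<1} - {v / d}" for h
  proof -
    have ne: "v - d * h \<noteq> 0" using that d by (auto simp: field_simps)
    have G': "(G has_real_derivative 1 / sqrt \<bar>u\<bar>) (at u)" if "u \<noteq> 0" for u
    proof (cases "u > 0")
      case True
      have "((\<lambda>u. 2 * sqrt u) has_real_derivative 1 / sqrt \<bar>u\<bar>) (at u)"
        using True by (auto intro!: derivative_eq_intros simp: field_simps)
      then show ?thesis
        by (rule DERIV_cong_ev[THEN iffD1, rotated -1])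
           (use True in \<open>auto simp: G_def eventually_nhds intro!: exI[of _ "{0<..}"]\<close>)
    next
      case False
      have "((\<lambda>u. - 2 * sqrt (-u)) has_real_derivative 1 / sqrt \<bar>u\<bar>) (at u)"
        using False that by (auto intro!: derivative_eq_intros simp: field_simps)
      then show ?thesis
        by (rule DERIV_cong_ev[THEN iffD1, rotated -1])
           (use False that in \<open>auto simp: G_def eventually_nhds intro!: exI[of _ "{..<0}"]\<close>)
    qed
    have "((\<lambda>h. G (v - d * h)) has_real_derivative (1 / sqrt \<bar>v - d * h\<bar>) * (- d)) (at h)"
      by (rule DERIV_chain2[where f=G and g="\<lambda>h. v - d * h", OF G'[OF ne]]) (auto intro!: derivative_eq_intros)
    then have "(F has_real_derivative - ((1 / sqrt \<bar>v - d * h\<bar>) * (- d)) / d) (at h)"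
      unfolding F_def by (intro DERIV_cdivide DERIV_minus)
    then show ?thesis using d
      by (simp add: has_real_derivative_iff_has_vector_derivative)
  qed
  \<comment> \<open>The strong form of the fundamental theorem tolerates the exceptional point
    \<open>v / d\<close>, where the integrand is singular; there only continuity of \<open>F\<close>
    is used.\<close>
  have "((\<lambda>h. 1 / sqrt \<bar>v - d * h\<bar>) has_integral (F 1 - F 0)) {0..1}"
    by (rule fundamental_theorem_of_calculus_interior_strong[of "{v/d}"]) (use der contF in auto)
  then have "(\<integral>\<^sup>+ h. ennreal (indicator {0..1} h * (1 / sqrt \<bar>v - d * h\<bar>)) \<partial>lborel) = ennreal (F 1 - F 0)"
    by (intro nn_integral_has_integral_lebesgue) auto
  moreover have "F 1 - F 0 = (G v - G (v - d)) / d"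
    by (simp add: F_def diff_divide_distrib)
  ultimately show ?thesis by simp
qed

text \<open>If the interval from \<open>v - d\<close> to \<open>v\<close> does not straddle 0,
  writing \<open>d\<close> as a difference of two squares gives the constant 2; if it does, the
  argument gives 3. The 4 is a convenient common bound.\<close>

lemma nn_integral_inverse_sqrt_le:
  assumes d: "0 < d" and v: "v \<noteq> 0"
  shows "(\<integral>\<^sup>+ h. ennreal (indicator {0..1} h / sqrt \<bar>v - d * h\<bar>) \<partial>lborel) \<le> ennreal (4 / sqrt \<bar>v\<bar>)"
proof -
  define G where "G = (\<lambda>u::real. 2 * sgn u * sqrt \<bar>u\<bar>)"
  have "G v - G (v - d) \<le> 4 * d / sqrt \<bar>v\<bar>"
  proof -
    consider "v < 0" | "0 < v" "d \<le> v" | "0 < v" "v < d" using v by linarith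
    then show ?thesis
    proof cases
      case 1
      define a b where "a = sqrt (-v)" and "b = sqrt (d - v)"
      have ab: "0 < a" "a \<le> b" "a * a = - v" "b * b = d - v" using 1 d by (auto simp: a_def b_def)
      have dd: "d = (b - a) * (b + a)" using ab by (simp add: algebra_simps)
      have "(2 * (b - a)) * a \<le> 4 * d" 
      proof -
        have "(b - a) * a \<le> (b - a) * (b + a)" using ab by (intro mult_left_mono) auto
        then show ?thesis using dd d by linarith
      qed
      then have "2 * (b - a) \<le> 4 * d / a" using ab by (simp add: field_simps)
      then show ?thesis using 1 d by (simp add: G_def a_def b_def)
    next
      case 2
      define a b where "a = sqrt v" and "b = sqrt (v - d)"
      have ab: "0 < a" "0 \<le> b" "b \<le> a" "a * a = v" "b * b = v - d" using 2 d by (auto simp: a_def b_def)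
      have dd: "d = (a - b) * (a + b)" using ab by (simp add: algebra_simps)
      have "(2 * (a - b)) * a \<le> 4 * d" 
      proof -
        have "(a - b) * a \<le> (a - b) * (a + b)" using ab by (intro mult_left_mono) auto
        then show ?thesis using dd d by linarith
      qed
      then have "2 * (a - b) \<le> 4 * d / a" using ab by (simp add: field_simps)
      moreover have "G (v - d) = 2 * b" using 2 by (simp add: G_def b_def sgn_if)
      ultimately show ?thesis using 2 d by (simp add: G_def a_def)
    next
      case 3
      define a b where "a = sqrt v" and "b = sqrt (d - v)"
      have ab: "0 < a" "0 \<le> b" "a * a = v" "b * b = d - v" using 3 d by (auto simp: a_def b_def)
      have "(2 * (a + b)) * a \<le> 4 * d" 
      proof -
        \<comment> \<open>Since \<open>a * a + b * b = d\<close>, the mixed term costs at most one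
          \<open>d\<close>, and \<open>2 * (a * a)\<close> at most two more.\<close>
        have "2 * (a * b) \<le> a * a + b * b" using sum_squares_bound[of a b] by (simp add: power2_eq_square)
        moreover have "a * a \<le> d" "a * a + b * b = d" using ab 3 by auto
        moreover have "(2 * (a + b)) * a = 2 * (a * a) + 2 * (a * b)" by (simp add: algebra_simps)
        ultimately show ?thesis using d by linarith
      qed
      then have "2 * (a + b) \<le> 4 * d / a" using ab by (simp add: field_simps)
      then show ?thesis using 3 d by (simp add: G_def a_def b_def)
    qed
  qed
  then have "(G v - G (v - d)) / d \<le> 4 / sqrt \<bar>v\<bar>" using d by (simp add: field_simps)
  then show ?thesis
    using nn_integral_inverse_sqrt[OF d, of v] by (simp add: G_def ennreal_leI)
qed

text \<open>After rescaling this is \<open>d\<close> times the average above. Wherever the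
  singularity sits in the interval, each boundary value is at most
  \<open>2 * sqrt d\<close>.\<close>

lemma nn_integral_inverse_sqrt_le_uniform:
  assumes d: "0 < d" and v: "0 \<le> v" "v \<le> d"
  shows "(\<integral>\<^sup>+ h. ennreal (indicator {0..d} h / sqrt \<bar>v - h\<bar>) \<partial>lborel) \<le> ennreal (4 * sqrt d)"
proof -
  have "(\<integral>\<^sup>+ h. ennreal (indicator {0..d} h / sqrt \<bar>v - h\<bar>) \<partial>lborel)
     = ennreal d * (\<integral>\<^sup>+ h. ennreal (indicator {0..1} h / sqrt \<bar>v - d * h\<bar>) \<partial>lborel)"
  proof -
    have *: "indicator {0..d} (d * h) = (indicator {0..1} h :: real)" for h
      using d by (auto simp: indicator_def zero_le_mult_iff)
    show ?thesis
      using nn_integral_real_affine[of "\<lambda>h. ennreal (indicator {0..d} h / sqrt \<bar>v - h\<bar>)" d 0] d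
      by (simp add: *)
  qed
  also have "\<dots> = ennreal (2 * sgn v * sqrt \<bar>v\<bar> - 2 * sgn (v - d) * sqrt \<bar>v - d\<bar>)"
    using d by (subst nn_integral_inverse_sqrt) (simp_all flip: ennreal_mult')
  also have "\<dots> \<le> ennreal (4 * sqrt d)"
  proof (rule ennreal_leI)
    have "sqrt v \<le> sqrt d" "sqrt (d - v) \<le> sqrt d" using v by auto
    moreover have "2 * sgn v * sqrt \<bar>v\<bar> = 2 * sqrt v" using v by (auto simp: sgn_if)
    moreover have "- 2 * sgn (v - d) * sqrt \<bar>v - d\<bar> = 2 * sqrt (d - v)" using v by (auto simp: sgn_if)
    ultimately show "2 * sgn v * sqrt \<bar>v\<bar> - 2 * sgn (v - d) * sqrt \<bar>v - d\<bar> \<le> 4 * sqrt d"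
      by linarith
  qed
  finally show ?thesis .
qed

section \<open>The energy of two smeared paths\<close>

lemma nn_integral_lborel_pair:
  fixes f :: "'a::euclidean_space \<times> 'b::euclidean_space \<Rightarrow> ennreal"
  assumes "f \<in> borel_measurable (borel \<Otimes>\<^sub>M borel)"
  shows "(\<integral>\<^sup>+ z. f z \<partial>lborel) = (\<integral>\<^sup>+ a. \<integral>\<^sup>+ b. f (a, b) \<partial>lborel \<partial>lborel)"
  using assms by (subst lborel_prod[symmetric], subst lborel.nn_integral_fst[symmetric])
    (simp_all cong: measurable_cong_sets)

lemma nn_integral_lborel_swap:
  fixes f :: "'a::euclidean_space \<Rightarrow> 'b::euclidean_space \<Rightarrow> ennreal"
  assumes "case_prod f \<in> borel_measurable (borel \<Otimes>\<^sub>M borel)"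
  shows "(\<integral>\<^sup>+ a. \<integral>\<^sup>+ b. f a b \<partial>lborel \<partial>lborel) = (\<integral>\<^sup>+ b. \<integral>\<^sup>+ a. f a b \<partial>lborel \<partial>lborel)"
  by (rule lborel_pair.Fubini') (use assms in \<open>simp cong: measurable_cong_sets\<close>)

lemma borel_measurable_nn_integral_lborel:
  assumes "case_prod f \<in> borel_measurable (M \<Otimes>\<^sub>M borel)"
  shows "(\<lambda>x. \<integral>\<^sup>+ y. f x y \<partial>lborel) \<in> borel_measurable M"
proof -
  have "case_prod f \<in> borel_measurable (M \<Otimes>\<^sub>M lborel)"
    using assms measurable_cong_sets[OF sets_pair_measure_cong[OF refl sets_lborel] refl] by blast
  then show ?thesis by (rule lborel.borel_measurable_nn_integral)
qed

text \<open>Grouping the variables into two points of the plane lets a single exchange move both. In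
  the energy computation this brings the path times outside and the noise times inside.\<close>

lemma nn_integral_lborel_swap_pairs:
  fixes f :: "real \<Rightarrow> real \<Rightarrow> real \<Rightarrow> real \<Rightarrow> ennreal"
  assumes [measurable]: "(\<lambda>((a, b), (c, d)). f a b c d) \<in> borel_measurable ((borel \<Otimes>\<^sub>M borel) \<Otimes>\<^sub>M (borel \<Otimes>\<^sub>M borel))"
  shows "(\<integral>\<^sup>+ a. \<integral>\<^sup>+ b. \<integral>\<^sup>+ c. \<integral>\<^sup>+ d. f a b c d \<partial>lborel \<partial>lborel \<partial>lborel \<partial>lborel)
       = (\<integral>\<^sup>+ c. \<integral>\<^sup>+ d. \<integral>\<^sup>+ a. \<integral>\<^sup>+ b. f a b c d \<partial>lborel \<partial>lborel \<partial>lborel \<partial>lborel)"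
proof -
  have m: "(\<lambda>(z, w). f (fst z) (snd z) (fst w) (snd w)) \<in> borel_measurable ((borel \<Otimes>\<^sub>M borel) \<Otimes>\<^sub>M (borel \<Otimes>\<^sub>M borel))"
    using assms by (simp add: split_beta')
  have 1: "(\<integral>\<^sup>+ c. \<integral>\<^sup>+ d. f a b c d \<partial>lborel \<partial>lborel) = (\<integral>\<^sup>+ z. f a b (fst z) (snd z) \<partial>lborel)" for a b
    using measurable_compose[OF _ m, of "\<lambda>z. ((a, b), z)"]
    by (subst nn_integral_lborel_pair) (simp_all add: split_beta')
  have 2: "(\<integral>\<^sup>+ a. \<integral>\<^sup>+ b. f a b c d \<partial>lborel \<partial>lborel) = (\<integral>\<^sup>+ z. f (fst z) (snd z) c d \<partial>lborel)" for c d
    using measurable_compose[OF _ m, of "\<lambda>z. (z, (c, d))"]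
    by (subst nn_integral_lborel_pair) (simp_all add: split_beta')
  have "(\<integral>\<^sup>+ a. \<integral>\<^sup>+ b. \<integral>\<^sup>+ z. f a b (fst z) (snd z) \<partial>lborel \<partial>lborel \<partial>lborel)
      = (\<integral>\<^sup>+ w. \<integral>\<^sup>+ z. f (fst w) (snd w) (fst z) (snd z) \<partial>lborel \<partial>lborel)"
  proof -
    have "(\<lambda>w. \<integral>\<^sup>+ z. f (fst w) (snd w) (fst z) (snd z) \<partial>lborel) \<in> borel_measurable (borel \<Otimes>\<^sub>M borel)"
      unfolding borel_prod using m
      by (intro borel_measurable_nn_integral_lborel) (simp add: borel_prod)
    from nn_integral_lborel_pair[OF this] show ?thesis by simp
  qed
  also have "\<dots> = (\<integral>\<^sup>+ z. \<integral>\<^sup>+ w. f (fst w) (snd w) (fst z) (snd z) \<partial>lborel \<partial>lborel)"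
    using m by (intro nn_integral_lborel_swap) (simp add: borel_prod)
  also have "\<dots> = (\<integral>\<^sup>+ c. \<integral>\<^sup>+ d. \<integral>\<^sup>+ z. f (fst z) (snd z) c d \<partial>lborel \<partial>lborel \<partial>lborel)"
  proof -
    have "(\<lambda>(w, z). f (fst z) (snd z) (fst w) (snd w)) \<in> borel_measurable ((borel \<Otimes>\<^sub>M borel) \<Otimes>\<^sub>M (borel \<Otimes>\<^sub>M borel))"
      using measurable_pair_swap[OF m] by (simp add: split_beta')
    then have "(\<lambda>z. \<integral>\<^sup>+ w. f (fst w) (snd w) (fst z) (snd z) \<partial>lborel) \<in> borel_measurable (borel \<Otimes>\<^sub>M borel)"
      unfolding borel_prod by (intro borel_measurable_nn_integral_lborel) (simp add: borel_prod)
    from nn_integral_lborel_pair[OF this] show ?thesis by simp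
  qed
  finally show ?thesis by (simp only: 1 2)
qed

section \<open>Time averaging and smeared paths\<close>

lemma borel_measurable_psi [measurable (raw)]:
  assumes [measurable]: "f \<in> borel_measurable M"
  shows "(\<lambda>x. psi d (f x)) \<in> borel_measurable M"
  unfolding psi_def by measurable

lemma psi_nonneg: "0 < d \<Longrightarrow> 0 \<le> psi d u"
  by (simp add: psi_def)

text \<open>Under \<open>r = a - \<delta> * h\<close> the Jacobian cancels the height of
  \<open>psi\<close>. The domain of integration no longer depends on \<open>\<delta>\<close>, so the
  limit can later be taken under the integral.\<close>

lemma nn_integral_psi:
  assumes pos: "0 < \<delta>" and [measurable]: "f \<in> borel_measurable borel"
  shows "(\<integral>\<^sup>+ r. ennreal (psi \<delta> (a - r)) * f r \<partial>lborel) = (\<integral>\<^sup>+ h. ennreal (indicator {0..1} h) * f (a - \<delta> * h) \<partial>lborel)"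
proof -
  have "(\<integral>\<^sup>+ r. ennreal (psi \<delta> (a - r)) * f r \<partial>lborel)
    = ennreal \<delta> * (\<integral>\<^sup>+ h. ennreal (psi \<delta> (\<delta> * h)) * f (a - \<delta> * h) \<partial>lborel)"
    using nn_integral_real_affine[of "\<lambda>r. ennreal (psi \<delta> (a - r)) * f r" "- \<delta>" a] pos by simp
  also have "\<dots> = (\<integral>\<^sup>+ h. ennreal \<delta> * ennreal (psi \<delta> (\<delta> * h)) * f (a - \<delta> * h) \<partial>lborel)"
    by (simp add: mult.assoc nn_integral_cmult)
  also have "\<dots> = (\<integral>\<^sup>+ h. ennreal (indicator {0..1} h) * f (a - \<delta> * h) \<partial>lborel)"
  proof -
    have "ennreal \<delta> * ennreal (psi \<delta> (\<delta> * h)) = ennreal (indicator {0..1} h)" for h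
      using pos by (auto simp: psi_def indicator_def zero_le_mult_iff simp flip: ennreal_mult)
    then show ?thesis by simp
  qed
  finally show ?thesis .
qed

text \<open>\<open>A_fun\<close> with a deterministic path as parameter, so that it applies to step
  paths and to cut-off paths as well as to \<open>X\<close>.\<close>

definition smear :: "real \<Rightarrow> real \<Rightarrow> real \<Rightarrow> real \<Rightarrow> (real \<Rightarrow> real) \<Rightarrow> real \<Rightarrow> real \<Rightarrow> real" where
  "smear \<epsilon> \<delta> t x p r y = (LINT s:{0..t}|lborel. psi \<delta> (t - s - r) * heat \<epsilon> (p s + x - y))"

lemma A_fun_eq_smear: "A_fun \<epsilon> \<delta> t x X \<xi> = smear \<epsilon> \<delta> t x (\<lambda>s. X s \<xi>)"
  by (simp add: A_fun_def smear_def fun_eq_iff)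

text \<open>This allows \<open>X\<close> to be replaced by a path cut off outside the time interval,
  for which joint measurability can be shown.\<close>

lemma smear_cong:
  assumes "\<And>s. 0 \<le> s \<Longrightarrow> s \<le> t \<Longrightarrow> p s = q s"
  shows "smear \<epsilon> \<delta> t x p = smear \<epsilon> \<delta> t x q"
  unfolding smear_def set_lebesgue_integral_def using assms
  by (intro ext Bochner_Integration.integral_cong) (auto simp: indicator_def)

lemma smear_nonneg: "0 < \<delta> \<Longrightarrow> 0 \<le> smear \<epsilon> \<delta> t x p r y"
  unfolding smear_def set_lebesgue_integral_def by (auto intro!: integral_nonneg_AE simp: psi_nonneg)

context
  fixes \<epsilon> \<delta> t x :: real and p :: "real \<Rightarrow> real"
  assumes pos: "0 < \<epsilon>" "0 < \<delta>" and p [measurable]: "p \<in> borel_measurable borel"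
begin

lemma borel_measurable_smear:
  assumes [measurable]: "f \<in> borel_measurable M" "g \<in> borel_measurable M"
  shows "(\<lambda>z. smear \<epsilon> \<delta> t x p (f z) (g z)) \<in> borel_measurable M"
  unfolding smear_def set_lebesgue_integral_def by measurable

text \<open>The integrand is at most \<open>1 / \<delta> * (1 / sqrt \<epsilon>)\<close> on an
  interval of finite length, so the Bochner integral is a genuine one and Tonelli becomes
  available.\<close>

lemma ennreal_smear:
  "ennreal (smear \<epsilon> \<delta> t x p r y)
    = (\<integral>\<^sup>+ s. ennreal (indicator {0..t} s * psi \<delta> (t - s - r)) * ennreal (heat \<epsilon> (p s + x - y)) \<partial>lborel)"
proof -
  have "integrable lborel (\<lambda>s. indicator {0..t} s *\<^sub>R (psi \<delta> (t - s - r) * heat \<epsilon> (p s + x - y)))"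
  proof (rule integrableI_bounded_set_indicator)
    show "AE s in lborel. s \<in> {0..t} \<longrightarrow> norm (psi \<delta> (t - s - r) * heat \<epsilon> (p s + x - y)) \<le> 1 / \<delta> * (1 / sqrt \<epsilon>)"
    proof (intro AE_I2 impI)
      fix s
      have "psi \<delta> (t - s - r) * heat \<epsilon> (p s + x - y) \<le> 1 / \<delta> * (1 / sqrt \<epsilon>)"
        using pos by (intro mult_mono heat_le_inverse_sqrt) (auto simp: psi_def indicator_def)
      then show "norm (psi \<delta> (t - s - r) * heat \<epsilon> (p s + x - y)) \<le> 1 / \<delta> * (1 / sqrt \<epsilon>)"
        using pos by (simp add: psi_nonneg abs_mult)
    qed
  qed (auto simp: emeasure_lborel_Icc_eq)
  then have "ennreal (smear \<epsilon> \<delta> t x p r y)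
    = (\<integral>\<^sup>+ s. ennreal (indicator {0..t} s *\<^sub>R (psi \<delta> (t - s - r) * heat \<epsilon> (p s + x - y))) \<partial>lborel)"
    unfolding smear_def set_lebesgue_integral_def using pos
    by (subst nn_integral_eq_integral) (auto simp: psi_nonneg)
  also have "\<dots> = (\<integral>\<^sup>+ s. ennreal (indicator {0..t} s * psi \<delta> (t - s - r)) * ennreal (heat \<epsilon> (p s + x - y)) \<partial>lborel)"
    using pos by (intro nn_integral_cong) (simp add: psi_nonneg mult.assoc flip: ennreal_mult)
  finally show ?thesis .
qed

text \<open>Tonelli brings the space integral inside, where the semigroup property adds
  \<open>v\<close> to the width \<open>\<epsilon>\<close>.\<close>

lemma nn_integral_smear_heat:
  assumes v: "0 < v"
  shows "(\<integral>\<^sup>+ y. ennreal (smear \<epsilon> \<delta> t x p r y) * ennreal (heat v (y - b)) \<partial>lborel)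
    = (\<integral>\<^sup>+ s. ennreal (indicator {0..t} s * psi \<delta> (t - s - r)) * ennreal (heat (\<epsilon> + v) (p s + x - b)) \<partial>lborel)"
proof -
  have "(\<integral>\<^sup>+ y. ennreal (smear \<epsilon> \<delta> t x p r y) * ennreal (heat v (y - b)) \<partial>lborel)
     = (\<integral>\<^sup>+ y. \<integral>\<^sup>+ s. ennreal (indicator {0..t} s * psi \<delta> (t - s - r)) * (ennreal (heat \<epsilon> (p s + x - y)) * ennreal (heat v (y - b))) \<partial>lborel \<partial>lborel)"
    by (simp add: ennreal_smear mult.assoc[symmetric] nn_integral_multc)
  also have "\<dots> = (\<integral>\<^sup>+ s. \<integral>\<^sup>+ y. ennreal (indicator {0..t} s * psi \<delta> (t - s - r)) * (ennreal (heat \<epsilon> (p s + x - y)) * ennreal (heat v (y - b))) \<partial>lborel \<partial>lborel)"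
    by (intro nn_integral_lborel_swap) measurable
  also have "\<dots> = (\<integral>\<^sup>+ s. ennreal (indicator {0..t} s * psi \<delta> (t - s - r)) * ennreal (heat (\<epsilon> + v) (p s + x - b)) \<partial>lborel)"
    using pos v by (simp add: nn_integral_cmult heat_semigroup)
  finally show ?thesis .
qed

end

lemma heat_minus_commute: "heat u (a - b) = heat u (b - a)"
  using heat_minus[of u "a - b"] by simp

text \<open>In \<open>rkernel\<close> the time variables of the inner product are substituted as
  \<open>r = t - s - \<delta> * h\<close> and \<open>r' = t - s' - \<delta>' * h'\<close>.\<close>

definition rkernel :: "real \<Rightarrow> real \<Rightarrow> real \<Rightarrow> real \<Rightarrow> real \<Rightarrow> real \<Rightarrow> real \<Rightarrow> real \<Rightarrow> real \<Rightarrow> real" where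
  "rkernel \<epsilon> \<delta> \<delta>' t s s' z h h' = indicator {0..1} h * indicator {0..1} h'
     * indicator {0..} (t - s - \<delta> * h) * indicator {0..} (t - s' - \<delta>' * h')
     * heat (\<epsilon> + \<bar>(s + \<delta> * h) - (s' + \<delta>' * h')\<bar>) z"

text \<open>Closed form of the inner product of two smeared paths. The semigroup property sees only
  the sum of the two spatial widths, here \<open>\<epsilon>\<close>, and a common starting point
  cancels in \<open>p s - q s'\<close>.\<close>

definition energy :: "real \<Rightarrow> real \<Rightarrow> real \<Rightarrow> real \<Rightarrow> (real \<Rightarrow> real) \<Rightarrow> (real \<Rightarrow> real) \<Rightarrow> ennreal" where
  "energy \<epsilon> \<delta> \<delta>' t p q = (\<integral>\<^sup>+ s. \<integral>\<^sup>+ s'. indicator {0..t} s * indicator {0..t} s' *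
      (\<integral>\<^sup>+ h. \<integral>\<^sup>+ h'. ennreal (rkernel \<epsilon> \<delta> \<delta>' t s s' (p s - q s') h h') \<partial>lborel \<partial>lborel) \<partial>lborel \<partial>lborel)"

lemma rkernel_nonneg [simp]: "0 \<le> rkernel \<epsilon> \<delta> \<delta>' t s s' z h h'"
  by (simp add: rkernel_def)

lemma borel_measurable_rkernel [measurable (raw)]:
  assumes [measurable]: "a \<in> borel_measurable M" "b \<in> borel_measurable M" "z \<in> borel_measurable M"
    "h \<in> borel_measurable M" "h' \<in> borel_measurable M"
  shows "(\<lambda>\<omega>. rkernel \<epsilon> \<delta> \<delta>' t (a \<omega>) (b \<omega>) (z \<omega>) (h \<omega>) (h' \<omega>)) \<in> borel_measurable M"
  unfolding rkernel_def by measurable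

text \<open>Space is integrated out before time: for fixed distinct noise times two uses of the
  semigroup property give a heat kernel of time
  \<open>\<epsilon> + \<epsilon>' + \<bar>r' - r\<bar>\<close>. After the exchange of the time
  pairs, the noise times become averages over the unit interval.\<close>

lemma nn_integral_H_kernel_smear:
  assumes pos: "0 < \<epsilon>" "0 < \<delta>" "0 < \<epsilon>'" "0 < \<delta>'"
    and [measurable]: "p \<in> borel_measurable borel" "q \<in> borel_measurable borel"
  shows "(\<integral>\<^sup>+ z. ennreal (H_kernel (smear \<epsilon> \<delta> t x p) (smear \<epsilon>' \<delta>' t x q) z) \<partial>lborel) = energy (\<epsilon> + \<epsilon>') \<delta> \<delta>' t p q"
proof -
  note [measurable (raw)] = borel_measurable_smear[OF pos(1,2)] borel_measurable_smear[OF pos(3,4)]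
  define f where "f = smear \<epsilon> \<delta> t x p"
  define g where "g = smear \<epsilon>' \<delta>' t x q"
  define c where "c = (\<lambda>s r. ennreal (indicator {0..t} s * psi \<delta> (t - s - r)))"
  define c' where "c' = (\<lambda>s r. ennreal (indicator {0..t} s * psi \<delta>' (t - s - r)))"
  define pos where "pos = (\<lambda>r::real. indicator {0..} r :: ennreal)"
  have nn: "0 \<le> f r y" "0 \<le> g r y" for r y using assms(2,4) by (auto simp: f_def g_def smear_nonneg)
  have inner: "(\<integral>\<^sup>+ y. \<integral>\<^sup>+ y'. ennreal (f r y) * (ennreal (g r' y') * ennreal (heat \<bar>r' - r\<bar> (y' - y))) \<partial>lborel \<partial>lborel)
     = (\<integral>\<^sup>+ s. \<integral>\<^sup>+ s'. c s r * c' s' r' * ennreal (heat (\<epsilon> + \<epsilon>' + \<bar>r' - r\<bar>) (p s - q s')) \<partial>lborel \<partial>lborel)"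
    if ne: "r \<noteq> r'" for r r'
  proof -
    have v: "0 < \<bar>r' - r\<bar>" "0 < \<epsilon>' + \<bar>r' - r\<bar>" using ne assms by auto
    have "(\<integral>\<^sup>+ y. \<integral>\<^sup>+ y'. ennreal (f r y) * (ennreal (g r' y') * ennreal (heat \<bar>r' - r\<bar> (y' - y))) \<partial>lborel \<partial>lborel)
      = (\<integral>\<^sup>+ y. \<integral>\<^sup>+ s'. ennreal (f r y) * (c' s' r' * ennreal (heat (\<epsilon>' + \<bar>r' - r\<bar>) (q s' + x - y))) \<partial>lborel \<partial>lborel)"
      using assms v unfolding f_def g_def c'_def
      by (simp add: nn_integral_cmult nn_integral_smear_heat)
    also have "\<dots> = (\<integral>\<^sup>+ s'. \<integral>\<^sup>+ y. c' s' r' * (ennreal (f r y) * ennreal (heat (\<epsilon>' + \<bar>r' - r\<bar>) (y - (q s' + x)))) \<partial>lborel \<partial>lborel)"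
      unfolding f_def c'_def
      by (subst nn_integral_lborel_swap) (measurable, simp add: mult_ac heat_minus_commute[of _ "_ + _"])
    also have "\<dots> = (\<integral>\<^sup>+ s'. \<integral>\<^sup>+ s. c' s' r' * (c s r * ennreal (heat (\<epsilon> + (\<epsilon>' + \<bar>r' - r\<bar>)) (p s + x - (q s' + x)))) \<partial>lborel \<partial>lborel)"
      using assms v unfolding f_def c_def c'_def
      by (simp add: nn_integral_cmult nn_integral_smear_heat)
    also have "\<dots> = (\<integral>\<^sup>+ s. \<integral>\<^sup>+ s'. c' s' r' * (c s r * ennreal (heat (\<epsilon> + (\<epsilon>' + \<bar>r' - r\<bar>)) (p s + x - (q s' + x)))) \<partial>lborel \<partial>lborel)"
      unfolding c_def c'_def by (rule nn_integral_lborel_swap) measurable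
    finally show ?thesis by (simp add: mult_ac add_ac)
  qed
  have "(\<integral>\<^sup>+ z. ennreal (H_kernel f g z) \<partial>lborel)
     = (\<integral>\<^sup>+ r. \<integral>\<^sup>+ y. \<integral>\<^sup>+ r'. \<integral>\<^sup>+ y'. ennreal (H_kernel f g ((r, y), (r', y'))) \<partial>lborel \<partial>lborel \<partial>lborel \<partial>lborel)"
  proof -
    have [measurable]: "H_kernel f g \<in> borel_measurable ((borel \<Otimes>\<^sub>M borel) \<Otimes>\<^sub>M (borel \<Otimes>\<^sub>M borel))"
      unfolding H_kernel_def f_def g_def split_beta' by measurable
    then have Hm: "H_kernel f g \<in> borel_measurable borel"
      by (simp add: borel_prod)
    then have [measurable]: "H_kernel f g \<in> borel_measurable (borel \<Otimes>\<^sub>M borel)"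
      by (simp add: borel_prod)
    have 1: "(\<integral>\<^sup>+ b. ennreal (H_kernel f g (a, b)) \<partial>lborel) = (\<integral>\<^sup>+ r'. \<integral>\<^sup>+ y'. ennreal (H_kernel f g (a, (r', y'))) \<partial>lborel \<partial>lborel)" for a
    proof (rule nn_integral_lborel_pair)
      have "H_kernel f g \<in> borel_measurable (borel \<Otimes>\<^sub>M (borel \<Otimes>\<^sub>M borel))"
        using Hm by (simp add: borel_prod)
      note [measurable] = this
      show "(\<lambda>b. ennreal (H_kernel f g (a, b))) \<in> borel_measurable (borel \<Otimes>\<^sub>M borel)"
        by measurable
    qed
    have 3: "(\<lambda>z. ennreal (H_kernel f g z)) \<in> borel_measurable borel"
      using Hm by measurable
    have 2: "(\<lambda>a. \<integral>\<^sup>+ b. ennreal (H_kernel f g (a, b)) \<partial>lborel) \<in> borel_measurable (borel \<Otimes>\<^sub>M borel)"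
      unfolding borel_prod by (rule borel_measurable_nn_integral_lborel) (use 3 in \<open>simp add: borel_prod split_beta'\<close>)
    show ?thesis
      by (subst nn_integral_lborel_pair, measurable, subst nn_integral_lborel_pair[OF 2], simp only: 1)
  qed
  also have "\<dots> = (\<integral>\<^sup>+ r. \<integral>\<^sup>+ y. \<integral>\<^sup>+ r'. \<integral>\<^sup>+ y'. pos r * (pos r' * (ennreal (f r y) * (ennreal (g r' y') * ennreal (heat \<bar>r' - r\<bar> (y' - y))))) \<partial>lborel \<partial>lborel \<partial>lborel \<partial>lborel)"
    using nn by (intro nn_integral_cong) (auto simp: H_kernel_def pos_def indicator_def ennreal_mult mult.assoc heat_minus_commute)
  also have "\<dots> = (\<integral>\<^sup>+ r. \<integral>\<^sup>+ r'. \<integral>\<^sup>+ y. \<integral>\<^sup>+ y'. pos r * (pos r' * (ennreal (f r y) * (ennreal (g r' y') * ennreal (heat \<bar>r' - r\<bar> (y' - y))))) \<partial>lborel \<partial>lborel \<partial>lborel \<partial>lborel)"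
    unfolding f_def g_def pos_def by (intro nn_integral_cong nn_integral_lborel_swap) measurable
  also have "\<dots> = (\<integral>\<^sup>+ r. \<integral>\<^sup>+ r'. pos r * (pos r' * (\<integral>\<^sup>+ y. \<integral>\<^sup>+ y'. (ennreal (f r y) * (ennreal (g r' y') * ennreal (heat \<bar>r' - r\<bar> (y' - y)))) \<partial>lborel \<partial>lborel)) \<partial>lborel \<partial>lborel)"
    unfolding f_def g_def pos_def by (simp add: nn_integral_cmult)
  also have "\<dots> = (\<integral>\<^sup>+ r. \<integral>\<^sup>+ r'. pos r * (pos r' * (\<integral>\<^sup>+ s. \<integral>\<^sup>+ s'. c s r * c' s' r' * ennreal (heat (\<epsilon> + \<epsilon>' + \<bar>r' - r\<bar>) (p s - q s')) \<partial>lborel \<partial>lborel)) \<partial>lborel \<partial>lborel)"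
  proof (rule nn_integral_cong, rule nn_integral_cong_AE)
    fix r :: real
    \<comment> \<open>The semigroup property needs a positive time, so the null set
      \<open>r' = r\<close> is discarded.\<close>
    have "AE r' in lborel. r' \<noteq> r" by (rule AE_lborel_singleton)
    then show "AE r' in lborel. pos r * (pos r' * (\<integral>\<^sup>+ y. \<integral>\<^sup>+ y'. (ennreal (f r y) * (ennreal (g r' y') * ennreal (heat \<bar>r' - r\<bar> (y' - y)))) \<partial>lborel \<partial>lborel))
       = pos r * (pos r' * (\<integral>\<^sup>+ s. \<integral>\<^sup>+ s'. c s r * c' s' r' * ennreal (heat (\<epsilon> + \<epsilon>' + \<bar>r' - r\<bar>) (p s - q s')) \<partial>lborel \<partial>lborel))"
      by eventually_elim (simp add: inner)
  qed
  also have "\<dots> = (\<integral>\<^sup>+ r. \<integral>\<^sup>+ r'. \<integral>\<^sup>+ s. \<integral>\<^sup>+ s'. pos r * (pos r' * (c s r * c' s' r' * ennreal (heat (\<epsilon> + \<epsilon>' + \<bar>r' - r\<bar>) (p s - q s')))) \<partial>lborel \<partial>lborel \<partial>lborel \<partial>lborel)"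
    unfolding c_def c'_def by (simp add: nn_integral_cmult)
  also have "\<dots> = (\<integral>\<^sup>+ s. \<integral>\<^sup>+ s'. \<integral>\<^sup>+ r. \<integral>\<^sup>+ r'. pos r * (pos r' * (c s r * c' s' r' * ennreal (heat (\<epsilon> + \<epsilon>' + \<bar>r' - r\<bar>) (p s - q s')))) \<partial>lborel \<partial>lborel \<partial>lborel \<partial>lborel)"
    unfolding c_def c'_def pos_def by (rule nn_integral_lborel_swap_pairs, unfold split_beta') measurable
  also have "\<dots> = energy (\<epsilon> + \<epsilon>') \<delta> \<delta>' t p q"
    unfolding energy_def
  proof (intro nn_integral_cong)
    fix s s' :: real
    define \<phi> where "\<phi> = (\<lambda>r r'. pos r * pos r' * ennreal (heat (\<epsilon> + \<epsilon>' + \<bar>r' - r\<bar>) (p s - q s')))"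
    have [measurable]: "case_prod \<phi> \<in> borel_measurable (borel \<Otimes>\<^sub>M borel)"
      unfolding \<phi>_def pos_def by measurable
    have [measurable]: "\<phi> r \<in> borel_measurable borel" for r
      unfolding \<phi>_def pos_def by measurable
    have cs: "c s r = indicator {0..t} s * ennreal (psi \<delta> (t - s - r))"
      "c' s' r' = indicator {0..t} s' * ennreal (psi \<delta>' (t - s' - r'))" for r r'
      by (auto simp: c_def c'_def indicator_def)
    have "(\<integral>\<^sup>+ r. \<integral>\<^sup>+ r'. pos r * (pos r' * (c s r * c' s' r' * ennreal (heat (\<epsilon> + \<epsilon>' + \<bar>r' - r\<bar>) (p s - q s')))) \<partial>lborel \<partial>lborel)
       = (\<integral>\<^sup>+ r. \<integral>\<^sup>+ r'. (indicator {0..t} s * indicator {0..t} s') * (ennreal (psi \<delta> (t - s - r)) * (ennreal (psi \<delta>' (t - s' - r')) * \<phi> r r')) \<partial>lborel \<partial>lborel)"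
      by (intro nn_integral_cong) (simp add: cs \<phi>_def mult_ac)
    also have "\<dots> = (indicator {0..t} s * indicator {0..t} s') * (\<integral>\<^sup>+ r. ennreal (psi \<delta> (t - s - r)) * (\<integral>\<^sup>+ r'. ennreal (psi \<delta>' (t - s' - r')) * \<phi> r r' \<partial>lborel) \<partial>lborel)"
      by (simp add: nn_integral_cmult)
    also have "(\<integral>\<^sup>+ r. ennreal (psi \<delta> (t - s - r)) * (\<integral>\<^sup>+ r'. ennreal (psi \<delta>' (t - s' - r')) * \<phi> r r' \<partial>lborel) \<partial>lborel)
       = (\<integral>\<^sup>+ h. ennreal (indicator {0..1} h) * (\<integral>\<^sup>+ h'. ennreal (indicator {0..1} h') * \<phi> (t - s - \<delta> * h) (t - s' - \<delta>' * h') \<partial>lborel) \<partial>lborel)"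
      using assms by (simp add: nn_integral_psi)
    also have "\<dots> = (\<integral>\<^sup>+ h. \<integral>\<^sup>+ h'. ennreal (rkernel (\<epsilon> + \<epsilon>') \<delta> \<delta>' t s s' (p s - q s') h h') \<partial>lborel \<partial>lborel)"
      unfolding rkernel_def \<phi>_def pos_def
      by (subst nn_integral_cmult[symmetric]) (measurable, auto intro!: nn_integral_cong simp: indicator_def algebra_simps)
    finally show "(\<integral>\<^sup>+ r. \<integral>\<^sup>+ r'. pos r * (pos r' * (c s r * c' s' r' * ennreal (heat (\<epsilon> + \<epsilon>' + \<bar>r' - r\<bar>) (p s - q s')))) \<partial>lborel \<partial>lborel)
      = indicator {0..t} s * indicator {0..t} s' * (\<integral>\<^sup>+ h. \<integral>\<^sup>+ h'. ennreal (rkernel (\<epsilon> + \<epsilon>') \<delta> \<delta>' t s s' (p s - q s') h h') \<partial>lborel \<partial>lborel)" .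
  qed
  finally show ?thesis by (simp add: f_def g_def)
qed

section \<open>Domination and convergence of the energy\<close>

text \<open>The constant is 4 times 4. The average over \<open>h'\<close> is taken on an interval
  ending at \<open>s - s' + \<delta> * h\<close>; up to sign this endpoint is
  \<open>(s' - s) - \<delta> * h\<close>, so the same one-sided estimate applies to the average over
  \<open>h\<close>. No width survives in the bound.\<close>

lemma nn_integral_rkernel_le:
  assumes "0 < \<epsilon>" "0 < \<delta>" "0 < \<delta>'" and ne: "s \<noteq> s'"
  shows "(\<integral>\<^sup>+ h. \<integral>\<^sup>+ h'. ennreal (rkernel \<epsilon> \<delta> \<delta>' t s s' z h h') \<partial>lborel \<partial>lborel) \<le> ennreal (16 / sqrt \<bar>s - s'\<bar>)"
proof -
  have 1: "(\<integral>\<^sup>+ h'. ennreal (rkernel \<epsilon> \<delta> \<delta>' t s s' z h h') \<partial>lborel)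
      \<le> ennreal 4 * ennreal (indicator {0..1} h / sqrt \<bar>(s' - s) - \<delta> * h\<bar>)" if h: "h \<noteq> (s' - s) / \<delta>" for h
  proof -
    have ne': "s - s' + \<delta> * h \<noteq> 0" using h assms by (auto simp: field_simps)
    have "AE h' in lborel. h' \<noteq> (s - s' + \<delta> * h) / \<delta>'" by (rule AE_lborel_singleton)
    then have "AE h' in lborel. ennreal (rkernel \<epsilon> \<delta> \<delta>' t s s' z h h')
        \<le> ennreal (indicator {0..1} h) * ennreal (indicator {0..1} h' / sqrt \<bar>(s - s' + \<delta> * h) - \<delta>' * h'\<bar>)"
    proof eventually_elim
      case (elim h')
      define u where "u = (s + \<delta> * h) - (s' + \<delta>' * h')"
      have u: "u \<noteq> 0" using elim assms by (auto simp: u_def field_simps)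
      have "heat (\<epsilon> + \<bar>u\<bar>) z \<le> 1 / sqrt (\<epsilon> + \<bar>u\<bar>)" using assms by (intro heat_le_inverse_sqrt) auto
      also have "\<dots> \<le> 1 / sqrt \<bar>u\<bar>" using u assms by (intro divide_left_mono) auto
      finally have "rkernel \<epsilon> \<delta> \<delta>' t s s' z h h' \<le> indicator {0..1} h * (indicator {0..1} h' / sqrt \<bar>u\<bar>)"
        by (auto simp: rkernel_def u_def indicator_def)
      moreover have "(s - s' + \<delta> * h) - \<delta>' * h' = u" by (simp add: u_def)
      ultimately show ?case by (simp add: ennreal_leI flip: ennreal_mult)
    qed
    then have "(\<integral>\<^sup>+ h'. ennreal (rkernel \<epsilon> \<delta> \<delta>' t s s' z h h') \<partial>lborel)
      \<le> (\<integral>\<^sup>+ h'. ennreal (indicator {0..1} h) * ennreal (indicator {0..1} h' / sqrt \<bar>(s - s' + \<delta> * h) - \<delta>' * h'\<bar>) \<partial>lborel)"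
      by (rule nn_integral_mono_AE)
    also have "\<dots> \<le> ennreal (indicator {0..1} h) * ennreal (4 / sqrt \<bar>s - s' + \<delta> * h\<bar>)"
      using nn_integral_inverse_sqrt_le[OF assms(3) ne'] by (subst nn_integral_cmult) (auto intro!: mult_left_mono)
    also have "\<dots> = ennreal 4 * ennreal (indicator {0..1} h / sqrt \<bar>(s' - s) - \<delta> * h\<bar>)"
    proof -
      have "\<bar>s - s' + \<delta> * h\<bar> = \<bar>(s' - s) - \<delta> * h\<bar>" by linarith
      then show ?thesis by (subst (1 2) ennreal_mult[symmetric]) auto
    qed
    finally show ?thesis .
  qed
  have "AE h in lborel. h \<noteq> (s' - s) / \<delta>" by (rule AE_lborel_singleton)
  then have "(\<integral>\<^sup>+ h. \<integral>\<^sup>+ h'. ennreal (rkernel \<epsilon> \<delta> \<delta>' t s s' z h h') \<partial>lborel \<partial>lborel)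
     \<le> (\<integral>\<^sup>+ h. ennreal 4 * ennreal (indicator {0..1} h / sqrt \<bar>(s' - s) - \<delta> * h\<bar>) \<partial>lborel)"
    by (intro nn_integral_mono_AE, eventually_elim) (rule 1)
  also have "\<dots> \<le> ennreal 4 * ennreal (4 / sqrt \<bar>s' - s\<bar>)"
    using nn_integral_inverse_sqrt_le[OF assms(2), of "s' - s"] ne by (subst nn_integral_cmult) (auto intro!: mult_left_mono)
  also have "\<dots> = ennreal (16 / sqrt \<bar>s - s'\<bar>)"
    by (subst ennreal_mult[symmetric]) (auto simp: abs_minus_commute)
  finally show ?thesis .
qed

lemma nn_integral_energy_dominator:
  assumes "0 < t" "0 \<le> s" "s \<le> t"
  shows "(\<integral>\<^sup>+ s'. indicator {0..t} s' * ennreal (16 / sqrt \<bar>s - s'\<bar>) \<partial>lborel) \<le> ennreal (64 * sqrt t)"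
proof -
  have "(\<integral>\<^sup>+ s'. indicator {0..t} s' * ennreal (16 / sqrt \<bar>s - s'\<bar>) \<partial>lborel)
    = (\<integral>\<^sup>+ s'. ennreal 16 * ennreal (indicator {0..t} s' / sqrt \<bar>s - s'\<bar>) \<partial>lborel)"
    by (intro nn_integral_cong, subst ennreal_mult[symmetric]) (auto simp: indicator_def)
  also have "\<dots> \<le> ennreal 16 * ennreal (4 * sqrt t)"
    using nn_integral_inverse_sqrt_le_uniform[OF assms] by (subst nn_integral_cmult) (auto intro!: mult_left_mono)
  also have "\<dots> = ennreal (64 * sqrt t)"
    using assms by (subst ennreal_mult[symmetric]) auto
  finally show ?thesis .
qed

lemma nn_integral_rkernel_inner_le:
  assumes "0 < \<epsilon>" "0 < \<delta>" "0 < \<delta>'" "0 < t"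
  shows "(\<integral>\<^sup>+ s'. indicator {0..t} s * indicator {0..t} s' *
      (\<integral>\<^sup>+ h. \<integral>\<^sup>+ h'. ennreal (rkernel \<epsilon> \<delta> \<delta>' t s s' (z s') h h') \<partial>lborel \<partial>lborel) \<partial>lborel)
    \<le> indicator {0..t} s * ennreal (64 * sqrt t)"
proof -
  have "AE s' in lborel. s' \<noteq> s" by (rule AE_lborel_singleton)
  then have "(\<integral>\<^sup>+ s'. indicator {0..t} s * indicator {0..t} s' *
      (\<integral>\<^sup>+ h. \<integral>\<^sup>+ h'. ennreal (rkernel \<epsilon> \<delta> \<delta>' t s s' (z s') h h') \<partial>lborel \<partial>lborel) \<partial>lborel)
    \<le> (\<integral>\<^sup>+ s'. indicator {0..t} s * (indicator {0..t} s' * ennreal (16 / sqrt \<bar>s - s'\<bar>)) \<partial>lborel)"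
    by (intro nn_integral_mono_AE, eventually_elim)
      (use assms in \<open>auto simp: mult.assoc intro!: mult_left_mono nn_integral_rkernel_le\<close>)
  also have "\<dots> \<le> indicator {0..t} s * ennreal (64 * sqrt t)"
    using nn_integral_energy_dominator[OF assms(4), of s]
    by (subst nn_integral_cmult) (auto simp: indicator_def)
  finally show ?thesis .
qed

text \<open>The factor 64 is 16 from the two averages times 4 from integrating over
  \<open>s'\<close>; the integral over \<open>s\<close> contributes \<open>t\<close>. Uniformity in
  widths and paths makes this constant a dominating function over the path law.\<close>

lemma energy_le:
  assumes "0 < \<epsilon>" "0 < \<delta>" "0 < \<delta>'" "0 < t"
  shows "energy \<epsilon> \<delta> \<delta>' t p q \<le> ennreal (64 * t * sqrt t)"
proof -
  have "energy \<epsilon> \<delta> \<delta>' t p q \<le> (\<integral>\<^sup>+ s. ennreal (64 * sqrt t) * indicator {0..t} s \<partial>lborel)"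
    unfolding energy_def using assms by (intro nn_integral_mono order_trans[OF nn_integral_rkernel_inner_le]) (auto simp: mult.commute)
  also have "\<dots> = ennreal (64 * t * sqrt t)"
    using assms by (subst nn_integral_cmult_indicator) (auto simp: mult_ac simp flip: ennreal_mult)
  finally show ?thesis .
qed

text \<open>Away from equal times the small shifts cannot reach the singularity, so dominated
  convergence on the unit square suffices. The displacement \<open>z\<close> varies with
  \<open>k\<close> because the paths themselves will be approximated.\<close>

lemma tendsto_nn_integral_rkernel:
  fixes z :: "nat \<Rightarrow> real"
  assumes pos: "\<And>k. 0 < \<epsilon> k" "\<And>k. 0 < \<delta> k" "\<And>k. 0 < \<delta>' k"
    and lim: "\<epsilon> \<longlonglongrightarrow> 0" "\<delta> \<longlonglongrightarrow> 0" "\<delta>' \<longlonglongrightarrow> 0" "z \<longlonglongrightarrow> z0"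
    and s: "s \<noteq> s'" "s < t" "s' < t"
  shows "(\<lambda>k. \<integral>\<^sup>+ h. \<integral>\<^sup>+ h'. ennreal (rkernel (\<epsilon> k) (\<delta> k) (\<delta>' k) t s s' (z k) h h') \<partial>lborel \<partial>lborel)
           \<longlonglongrightarrow> ennreal (heat \<bar>s - s'\<bar> z0)"
proof -
  have ss: "0 < \<bar>s - s'\<bar>" using s by simp
  have "eventually (\<lambda>k. \<delta> k < \<bar>s - s'\<bar> / 4) sequentially" "eventually (\<lambda>k. \<delta>' k < \<bar>s - s'\<bar> / 4) sequentially"
    using order_tendstoD(2)[OF lim(2), of "\<bar>s - s'\<bar> / 4"] order_tendstoD(2)[OF lim(3), of "\<bar>s - s'\<bar> / 4"] ss by auto
  then have "eventually (\<lambda>k. \<delta> k < \<bar>s - s'\<bar> / 4 \<and> \<delta>' k < \<bar>s - s'\<bar> / 4) sequentially"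
    by eventually_elim auto
  \<comment> \<open>Once both shifts are below a quarter of the gap, the shifted times remain at
    least half the gap apart. The sequence is started at \<open>N\<close> so that the dominating
    bound holds for all its terms.\<close>
  then obtain N where N: "\<And>k. k \<ge> N \<Longrightarrow> \<delta> k < \<bar>s - s'\<bar> / 4 \<and> \<delta>' k < \<bar>s - s'\<bar> / 4"
    by (auto simp: eventually_sequentially)
  have half_le: "a / 2 \<le> b" if "c \<le> a / 4" "a \<le> b + c" "0 < a" for a b c :: real
    using that by linarith
  define I where "I = (\<lambda>w::real \<times> real. indicator {0..1} (fst w) * indicator {0..1} (snd w) :: real)"
  define r where "r = (\<lambda>k (w::real \<times> real). ennreal (rkernel (\<epsilon> k) (\<delta> k) (\<delta>' k) t s s' (z k) (fst w) (snd w)))"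
  have pair: "(\<integral>\<^sup>+ h. \<integral>\<^sup>+ h'. ennreal (rkernel (\<epsilon> k) (\<delta> k) (\<delta>' k) t s s' (z k) h h') \<partial>lborel \<partial>lborel) = (\<integral>\<^sup>+ w. r k w \<partial>lborel)" for k
    unfolding r_def by (subst nn_integral_lborel_pair) auto
  have I1: "(\<integral>\<^sup>+ w. ennreal (c * I w) \<partial>lborel) = ennreal c" if "0 \<le> c" for c
  proof -
    have "(\<integral>\<^sup>+ w. ennreal (c * I w) \<partial>lborel) = (\<integral>\<^sup>+ h. \<integral>\<^sup>+ h'. ennreal c * (indicator {0..1} h * indicator {0..1::real} h') \<partial>lborel \<partial>(lborel :: real measure))"
      unfolding I_def using that
      by (subst nn_integral_lborel_pair) (auto intro!: nn_integral_cong simp: indicator_def)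
    also have "\<dots> = ennreal c"
      by (simp add: nn_integral_cmult)
    finally show ?thesis .
  qed
  have "(\<lambda>k. \<integral>\<^sup>+ w. r (k + N) w \<partial>lborel) \<longlonglongrightarrow> (\<integral>\<^sup>+ w. ennreal (heat \<bar>s - s'\<bar> z0 * I w) \<partial>lborel)"
  proof (rule nn_integral_dominated_convergence[where w = "\<lambda>w. ennreal (1 / sqrt (\<bar>s - s'\<bar> / 2) * I w)"])
    show "r (k + N) \<in> borel_measurable lborel" for k
      unfolding r_def by (simp add: borel_prod[symmetric])
    show "(\<lambda>w. ennreal (heat \<bar>s - s'\<bar> z0 * I w)) \<in> borel_measurable lborel"
      "(\<lambda>w. ennreal (1 / sqrt (\<bar>s - s'\<bar> / 2) * I w)) \<in> borel_measurable lborel"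
      unfolding I_def by (simp_all add: borel_prod[symmetric])
    show "(\<integral>\<^sup>+ w. ennreal (1 / sqrt (\<bar>s - s'\<bar> / 2) * I w) \<partial>lborel) < \<infinity>"
      by (subst I1) auto
    show "AE w in lborel. r (k + N) w \<le> ennreal (1 / sqrt (\<bar>s - s'\<bar> / 2) * I w)" for k
    proof (intro AE_I2)
      fix w :: "real \<times> real"
      define h h' where "h = fst w" and "h' = snd w"
      define m where "m = k + N"
      define u where "u = (s + \<delta> m * h) - (s' + \<delta>' m * h')"
      show "r (k + N) w \<le> ennreal (1 / sqrt (\<bar>s - s'\<bar> / 2) * I w)"
      proof (cases "h \<in> {0..1} \<and> h' \<in> {0..1}")
        case True
        have "0 \<le> \<delta> m * h" "\<delta> m * h \<le> \<delta> m" "0 \<le> \<delta>' m * h'" "\<delta>' m * h' \<le> \<delta>' m"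
          using True pos[of m] by (auto intro!: mult_left_le)
        moreover have "\<delta> m < \<bar>s - s'\<bar> / 4" "\<delta>' m < \<bar>s - s'\<bar> / 4" using N[of m] by (auto simp: m_def)
        ultimately have "\<bar>\<delta> m * h - \<delta>' m * h'\<bar> \<le> \<bar>s - s'\<bar> / 4" by linarith
        moreover have "\<bar>s - s'\<bar> \<le> \<bar>u\<bar> + \<bar>\<delta> m * h - \<delta>' m * h'\<bar>" unfolding u_def by linarith
        ultimately have u: "\<bar>s - s'\<bar> / 2 \<le> \<bar>u\<bar>" using ss half_le by blast
        have "heat (\<epsilon> m + \<bar>u\<bar>) (z m) \<le> 1 / sqrt (\<epsilon> m + \<bar>u\<bar>)" using pos[of m] by (intro heat_le_inverse_sqrt) auto
        also have "\<dots> \<le> 1 / sqrt (\<bar>s - s'\<bar> / 2)"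
          using u ss pos(1)[of m] by (intro divide_left_mono mult_pos_pos) auto
        finally have "rkernel (\<epsilon> m) (\<delta> m) (\<delta>' m) t s s' (z m) h h' \<le> 1 / sqrt (\<bar>s - s'\<bar> / 2)"
          using ss by (auto simp: rkernel_def u_def indicator_def)
        then show ?thesis using True by (simp add: r_def I_def h_def h'_def m_def ennreal_leI)
      next
        case False
        then show ?thesis by (auto simp: r_def rkernel_def h_def h'_def)
      qed
    qed
    show "AE w in lborel. (\<lambda>k. r (k + N) w) \<longlonglongrightarrow> ennreal (heat \<bar>s - s'\<bar> z0 * I w)"
    proof (intro AE_I2 LIMSEQ_ignore_initial_segment)
      fix w :: "real \<times> real"
      define h h' where "h = fst w" and "h' = snd w"
      have l: "(\<lambda>k. t - s - \<delta> k * h) \<longlonglongrightarrow> t - s - 0 * h" "(\<lambda>k. t - s' - \<delta>' k * h') \<longlonglongrightarrow> t - s' - 0 * h'"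
        by (intro tendsto_intros lim)+
      \<comment> \<open>Strict inequality \<open>s < t\<close>, \<open>s' < t\<close> makes both
        cut-offs at time 0 inactive eventually; at the endpoint they would depend on the sign of
        \<open>h\<close>.\<close>
      have "eventually (\<lambda>k. 0 < t - s - \<delta> k * h) sequentially" "eventually (\<lambda>k. 0 < t - s' - \<delta>' k * h') sequentially"
        using order_tendstoD(1)[OF l(1), of 0] order_tendstoD(1)[OF l(2), of 0] s by auto
      then have ev: "eventually (\<lambda>k. I w * heat (\<epsilon> k + \<bar>(s + \<delta> k * h) - (s' + \<delta>' k * h')\<bar>) (z k)
          = rkernel (\<epsilon> k) (\<delta> k) (\<delta>' k) t s s' (z k) h h') sequentially"
        by eventually_elim (simp add: rkernel_def I_def h_def h'_def)
      have "(\<lambda>k. \<epsilon> k + \<bar>(s + \<delta> k * h) - (s' + \<delta>' k * h')\<bar>) \<longlonglongrightarrow> 0 + \<bar>(s + 0 * h) - (s' + 0 * h')\<bar>"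
        by (intro tendsto_intros lim)
      then have "(\<lambda>k. I w * heat (\<epsilon> k + \<bar>(s + \<delta> k * h) - (s' + \<delta>' k * h')\<bar>) (z k)) \<longlonglongrightarrow> I w * heat \<bar>s - s'\<bar> z0"
        using lim ss by (intro tendsto_intros tendsto_heat) auto
      then have "(\<lambda>k. rkernel (\<epsilon> k) (\<delta> k) (\<delta>' k) t s s' (z k) h h') \<longlonglongrightarrow> I w * heat \<bar>s - s'\<bar> z0"
        by (rule Lim_transform_eventually[OF _ ev])
      then show "(\<lambda>k. r k w) \<longlonglongrightarrow> ennreal (heat \<bar>s - s'\<bar> z0 * I w)"
        unfolding r_def h_def h'_def by (intro tendsto_ennrealI) (simp add: mult.commute)
    qed
  qed
  then have "(\<lambda>k. \<integral>\<^sup>+ w. r k w \<partial>lborel) \<longlonglongrightarrow> ennreal (heat \<bar>s - s'\<bar> z0)"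
    by (simp add: I1 LIMSEQ_offset[of "\<lambda>k. \<integral>\<^sup>+ w. r k w \<partial>lborel" N])
  then show ?thesis by (simp add: pair)
qed

text \<open>Common limit of the energies as all widths vanish; for \<open>p = q\<close> it is the
  claimed variance.\<close>

definition energy0 :: "real \<Rightarrow> (real \<Rightarrow> real) \<Rightarrow> (real \<Rightarrow> real) \<Rightarrow> ennreal" where
  "energy0 t p q = (\<integral>\<^sup>+ s. \<integral>\<^sup>+ s'. indicator {0..t} s * indicator {0..t} s' * ennreal (heat \<bar>s - s'\<bar> (p s - q s')) \<partial>lborel \<partial>lborel)"

text \<open>Dominated convergence is used twice, in \<open>s'\<close> under the inverse square root
  of the gap and in \<open>s\<close> under a constant on the time interval. Both bounds are uniform
  in the widths and in the paths.\<close>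

lemma tendsto_energy:
  fixes p q :: "nat \<Rightarrow> real \<Rightarrow> real"
  assumes pos: "\<And>k. 0 < \<epsilon> k" "\<And>k. 0 < \<delta> k" "\<And>k. 0 < \<delta>' k" "0 < t"
    and lim: "\<epsilon> \<longlonglongrightarrow> 0" "\<delta> \<longlonglongrightarrow> 0" "\<delta>' \<longlonglongrightarrow> 0"
    and plim: "\<And>s. 0 \<le> s \<Longrightarrow> s \<le> t \<Longrightarrow> (\<lambda>k. p k s) \<longlonglongrightarrow> p0 s"
    and qlim: "\<And>s. 0 \<le> s \<Longrightarrow> s \<le> t \<Longrightarrow> (\<lambda>k. q k s) \<longlonglongrightarrow> q0 s"
    and [measurable]: "\<And>k. p k \<in> borel_measurable borel" "\<And>k. q k \<in> borel_measurable borel"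
      "p0 \<in> borel_measurable borel" "q0 \<in> borel_measurable borel"
  shows "(\<lambda>k. energy (\<epsilon> k) (\<delta> k) (\<delta>' k) t (p k) (q k)) \<longlonglongrightarrow> energy0 t p0 q0"
  unfolding energy_def energy0_def
proof (rule nn_integral_dominated_convergence[where w = "\<lambda>s. indicator {0..t} s * ennreal (64 * sqrt t)"])
  show "(\<integral>\<^sup>+ s. indicator {0..t} s * ennreal (64 * sqrt t) \<partial>lborel) < \<infinity>"
    using pos by (subst nn_integral_multc) (auto simp flip: ennreal_mult)
  show "AE s in lborel. (\<integral>\<^sup>+ s'. indicator {0..t} s * indicator {0..t} s' *
      (\<integral>\<^sup>+ h. \<integral>\<^sup>+ h'. ennreal (rkernel (\<epsilon> k) (\<delta> k) (\<delta>' k) t s s' (p k s - q k s') h h') \<partial>lborel \<partial>lborel) \<partial>lborel)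
     \<le> indicator {0..t} s * ennreal (64 * sqrt t)" for k
    using pos by (intro AE_I2 nn_integral_rkernel_inner_le)
  \<comment> \<open>The pointwise limit of the kernel is available only for times before
    \<open>t\<close>.\<close>
  have "AE s in lborel. s \<noteq> t" by (rule AE_lborel_singleton)
  then show "AE s in lborel. (\<lambda>k. \<integral>\<^sup>+ s'. indicator {0..t} s * indicator {0..t} s' *
      (\<integral>\<^sup>+ h. \<integral>\<^sup>+ h'. ennreal (rkernel (\<epsilon> k) (\<delta> k) (\<delta>' k) t s s' (p k s - q k s') h h') \<partial>lborel \<partial>lborel) \<partial>lborel)
     \<longlonglongrightarrow> (\<integral>\<^sup>+ s'. indicator {0..t} s * indicator {0..t} s' * ennreal (heat \<bar>s - s'\<bar> (p0 s - q0 s')) \<partial>lborel)"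
  proof eventually_elim
    case (elim s)
    show ?case
    proof (cases "s \<in> {0..t}")
      case True
      show ?thesis
      proof (rule nn_integral_dominated_convergence[where w = "\<lambda>s'. indicator {0..t} s' * ennreal (16 / sqrt \<bar>s - s'\<bar>)"])
        show "(\<integral>\<^sup>+ s'. indicator {0..t} s' * ennreal (16 / sqrt \<bar>s - s'\<bar>) \<partial>lborel) < \<infinity>"
          using nn_integral_energy_dominator[of t s] pos True by (auto simp: le_less_trans)
        have ne: "AE s' in lborel. s' \<noteq> s" "AE s' in lborel. s' \<noteq> t" by (rule AE_lborel_singleton)+
        show "AE s' in lborel. indicator {0..t} s * indicator {0..t} s' *
            (\<integral>\<^sup>+ h. \<integral>\<^sup>+ h'. ennreal (rkernel (\<epsilon> k) (\<delta> k) (\<delta>' k) t s s' (p k s - q k s') h h') \<partial>lborel \<partial>lborel)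
          \<le> indicator {0..t} s' * ennreal (16 / sqrt \<bar>s - s'\<bar>)" for k
          using ne(1) by eventually_elim
            (use True pos in \<open>auto intro!: mult_left_mono nn_integral_rkernel_le\<close>)
        show "AE s' in lborel. (\<lambda>k. indicator {0..t} s * indicator {0..t} s' *
            (\<integral>\<^sup>+ h. \<integral>\<^sup>+ h'. ennreal (rkernel (\<epsilon> k) (\<delta> k) (\<delta>' k) t s s' (p k s - q k s') h h') \<partial>lborel \<partial>lborel))
          \<longlonglongrightarrow> indicator {0..t} s * indicator {0..t} s' * ennreal (heat \<bar>s - s'\<bar> (p0 s - q0 s'))"
          using ne
        proof eventually_elim
          case (elim s')
          show ?case
          proof (cases "s' \<in> {0..t}")
            case s': True
            have "(\<lambda>k. p k s - q k s') \<longlonglongrightarrow> p0 s - q0 s'"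
              using True s' by (intro tendsto_diff plim qlim) auto
            from tendsto_nn_integral_rkernel[OF pos(1-3) lim this, of s s' t]
            show ?thesis using True s' \<open>s \<noteq> t\<close> elim by auto
          qed auto
        qed
      qed measurable
    qed auto
  qed
qed measurable

section \<open>Gaussian variables and the isonormal process\<close>

lemma integrable_H_kernel_smear:
  fixes x :: real
  assumes pos: "0 < \<epsilon>" "0 < \<delta>" "0 < \<epsilon>'" "0 < \<delta>'" "0 < t"
    and pq: "p \<in> borel_measurable borel" "q \<in> borel_measurable borel"
  defines "f \<equiv> smear \<epsilon> \<delta> t x p" and "g \<equiv> smear \<epsilon>' \<delta>' t x q"
  shows "integrable lborel (H_kernel f g)" "H_inner f g = enn2real (energy (\<epsilon> + \<epsilon>') \<delta> \<delta>' t p q)"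
proof -
  note [measurable (raw)] = borel_measurable_smear[OF pos(1,2) pq(1)] borel_measurable_smear[OF pos(3,4) pq(2)]
  have "H_kernel f g \<in> borel_measurable ((borel \<Otimes>\<^sub>M borel) \<Otimes>\<^sub>M (borel \<Otimes>\<^sub>M borel))"
    unfolding H_kernel_def f_def g_def split_beta' by measurable
  then have m: "H_kernel f g \<in> borel_measurable lborel"
    by (simp add: borel_prod)
  have nn: "0 \<le> H_kernel f g z" for z
    using pos by (auto simp: H_kernel_def f_def g_def smear_nonneg split: prod.split)
  have e: "(\<integral>\<^sup>+ z. ennreal (H_kernel f g z) \<partial>lborel) = energy (\<epsilon> + \<epsilon>') \<delta> \<delta>' t p q"
    unfolding f_def g_def using pos pq by (intro nn_integral_H_kernel_smear)
  have "energy (\<epsilon> + \<epsilon>') \<delta> \<delta>' t p q < \<infinity>"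
    using energy_le[of "\<epsilon> + \<epsilon>'" \<delta> \<delta>' t p q] pos by (auto simp: le_less_trans)
  then show "integrable lborel (H_kernel f g)"
    by (intro integrableI_nonneg m) (auto simp: nn e)
  show "H_inner f g = enn2real (energy (\<epsilon> + \<epsilon>') \<delta> \<delta>' t p q)"
    unfolding H_inner_def using nn m e by (simp add: integral_eq_nn_integral)
qed

lemma H_admissible_smear:
  assumes pos: "0 < \<epsilon>" "0 < \<delta>" "0 < t" and p: "p \<in> borel_measurable borel"
  shows "H_admissible (smear \<epsilon> \<delta> t x p)"
proof -
  note [measurable (raw)] = borel_measurable_smear[OF pos(1,2) p]
  have "(\<lambda>(s, u). smear \<epsilon> \<delta> t x p s u) \<in> borel_measurable (borel \<Otimes>\<^sub>M borel)"
    by measurable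
  then have "(\<lambda>(s, u). smear \<epsilon> \<delta> t x p s u) \<in> borel_measurable lborel"
    by (simp add: borel_prod)
  moreover have "(\<lambda>s u. \<bar>smear \<epsilon> \<delta> t x p s u\<bar>) = smear \<epsilon> \<delta> t x p"
    using pos by (simp add: fun_eq_iff smear_nonneg)
  ultimately show ?thesis
    using pos p by (simp add: H_admissible_def integrable_H_kernel_smear)
qed

text \<open>Expanding the square needs integrable cross terms, and admissibility of the difference
  follows from \<bar>f - g\<bar> \<le> f + g. The coefficients \<open>1\<close> and
  \<open>- 1\<close> are kept visible to match the linearity clause of
  \<open>isonormal\<close>.\<close>

lemma H_admissible_diff:
  assumes adm: "H_admissible f" "H_admissible g"
    and nn: "\<And>r y. 0 \<le> f r y" "\<And>r y. 0 \<le> g r y"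
    and int: "integrable lborel (H_kernel f g)" "integrable lborel (H_kernel g f)"
  shows "H_admissible (\<lambda>r y. 1 * f r y + (- 1) * g r y)"
    and "H_inner (\<lambda>r y. 1 * f r y + (- 1) * g r y) (\<lambda>r y. 1 * f r y + (- 1) * g r y)
         = H_inner f f - H_inner f g - H_inner g f + H_inner g g"
proof -
  define k where "k = (\<lambda>r y. 1 * f r y + (- 1) * g r y)"
  have abs: "(\<lambda>s u. \<bar>f s u\<bar>) = f" "(\<lambda>s u. \<bar>g s u\<bar>) = g" using nn by (auto simp: fun_eq_iff)
  have fm: "(\<lambda>(s, u). f s u) \<in> borel_measurable lborel" and gm: "(\<lambda>(s, u). g s u) \<in> borel_measurable lborel"
    and iff: "integrable lborel (H_kernel f f)" and igg: "integrable lborel (H_kernel g g)"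
    using adm by (auto simp: H_admissible_def abs)
  have "(\<lambda>z. 1 * (case z of (s, u) \<Rightarrow> f s u) + (- 1) * (case z of (s, u) \<Rightarrow> g s u)) \<in> borel_measurable lborel"
    by (intro borel_measurable_add borel_measurable_times borel_measurable_const fm gm)
  then have km: "(\<lambda>(s, u). k s u) \<in> borel_measurable lborel"
    by (simp add: k_def split_beta')
  have kmb [measurable]: "(\<lambda>z. k (fst z) (snd z)) \<in> borel_measurable (borel \<Otimes>\<^sub>M borel)"
    using km by (simp add: borel_prod split_beta')
  have [measurable (raw)]: "(\<lambda>z. k (a z) (b z)) \<in> borel_measurable M"
    if [measurable]: "a \<in> borel_measurable M" "b \<in> borel_measurable M" for a b and M :: "'a measure"
    using measurable_compose[OF measurable_Pair[OF that] kmb] by simp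
  have "H_kernel (\<lambda>s u. \<bar>k s u\<bar>) (\<lambda>s u. \<bar>k s u\<bar>) \<in> borel_measurable ((borel \<Otimes>\<^sub>M borel) \<Otimes>\<^sub>M (borel \<Otimes>\<^sub>M borel))"
    unfolding H_kernel_def split_beta' by measurable
  then have am: "H_kernel (\<lambda>s u. \<bar>k s u\<bar>) (\<lambda>s u. \<bar>k s u\<bar>) \<in> borel_measurable lborel"
    by (simp add: borel_prod)
  have iab: "integrable lborel (H_kernel (\<lambda>s u. \<bar>k s u\<bar>) (\<lambda>s u. \<bar>k s u\<bar>))"
  proof (rule Bochner_Integration.integrable_bound[OF _ am])
    show "integrable lborel (\<lambda>z. H_kernel f f z + H_kernel f g z + H_kernel g f z + H_kernel g g z)"
      using iff igg int by (intro Bochner_Integration.integrable_add)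
    show "AE z in lborel. norm (H_kernel (\<lambda>s u. \<bar>k s u\<bar>) (\<lambda>s u. \<bar>k s u\<bar>) z)
        \<le> norm (H_kernel f f z + H_kernel f g z + H_kernel g f z + H_kernel g g z)"
    proof (intro AE_I2, safe)
      fix s u r v :: real
      define c where "c = indicator {0..} s * indicator {0..} r * heat \<bar>r - s\<bar> (u - v)"
      have c: "0 \<le> c" by (simp add: c_def)
      have "\<bar>k s u\<bar> * \<bar>k r v\<bar> \<le> (f s u + g s u) * (f r v + g r v)"
        using nn[of s u] nn[of r v] nn(1)[of s u] nn(1)[of r v] nn(2)[of s u] nn(2)[of r v]
        by (intro mult_mono) (auto simp: k_def)
      then have "c * (\<bar>k s u\<bar> * \<bar>k r v\<bar>) \<le> c * ((f s u + g s u) * (f r v + g r v))"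
        by (rule mult_left_mono[OF _ c])
      moreover have "H_kernel (\<lambda>s u. \<bar>k s u\<bar>) (\<lambda>s u. \<bar>k s u\<bar>) ((s, u), (r, v)) = c * (\<bar>k s u\<bar> * \<bar>k r v\<bar>)"
        by (simp add: H_kernel_def c_def mult_ac)
      moreover have "H_kernel f f ((s,u),(r,v)) + H_kernel f g ((s,u),(r,v)) + H_kernel g f ((s,u),(r,v)) + H_kernel g g ((s,u),(r,v))
          = c * ((f s u + g s u) * (f r v + g r v))"
        by (simp add: H_kernel_def c_def algebra_simps)
      moreover have "0 \<le> c * (\<bar>k s u\<bar> * \<bar>k r v\<bar>)" using c by simp
      ultimately show "norm (H_kernel (\<lambda>s u. \<bar>k s u\<bar>) (\<lambda>s u. \<bar>k s u\<bar>) ((s, u), (r, v)))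
        \<le> norm (H_kernel f f ((s,u),(r,v)) + H_kernel f g ((s,u),(r,v)) + H_kernel g f ((s,u),(r,v)) + H_kernel g g ((s,u),(r,v)))"
        by simp
    qed
  qed
  then show "H_admissible (\<lambda>r y. 1 * f r y + (- 1) * g r y)"
    using km by (simp add: H_admissible_def k_def)
  have eq: "H_kernel k k = (\<lambda>z. H_kernel f f z - H_kernel f g z - H_kernel g f z + H_kernel g g z)"
    by (auto simp: fun_eq_iff H_kernel_def k_def algebra_simps)
  show "H_inner (\<lambda>r y. 1 * f r y + (- 1) * g r y) (\<lambda>r y. 1 * f r y + (- 1) * g r y)
         = H_inner f f - H_inner f g - H_inner g f + H_inner g g"
    unfolding H_inner_def k_def[symmetric] eq using iff igg int by simp
qed

text \<open>Fatou's lemma for \<open>2 (1 - cos (\<theta> Y)) / \<theta>\<^sup>2 \<longrightarrow> Y\<^sup>2\<close>; this covers the degenerate Gaussian as well.\<close>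

lemma (in prob_space) second_moment_le_of_char:
  assumes [measurable]: "Y \<in> borel_measurable M"
    and char: "\<And>\<theta>. char (distr M borel Y) \<theta> = complex_of_real (exp (- (\<theta>\<^sup>2 * v) / 2))"
  shows "(\<integral>\<^sup>+ w. ennreal ((Y w)\<^sup>2) \<partial>M) \<le> ennreal v"
proof -
  define \<theta> where "\<theta> = (\<lambda>n. 1 / real (Suc n))"
  have \<theta>0: "\<theta> n > 0" for n by (simp add: \<theta>_def)
  define u where "u = (\<lambda>n w. 2 * (1 - cos (\<theta> n * Y w)) / (\<theta> n)\<^sup>2)"
  have u_nonneg: "0 \<le> u n w" for n w by (simp add: u_def)
  have int: "(\<integral>\<^sup>+ w. ennreal (u n w) \<partial>M) \<le> ennreal v" for n
  proof -
    have ii: "integrable M (\<lambda>w. iexp (\<theta> n * Y w))"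
      by (rule integrable_const_bound[of _ 1]) auto
    have ic: "integrable M (\<lambda>w. cos (\<theta> n * Y w))"
      by (rule integrable_const_bound[of _ 1]) auto
    have "expectation (\<lambda>w. cos (\<theta> n * Y w)) = Re (char (distr M borel Y) (\<theta> n))"
      using integral_bounded_linear[OF bounded_linear_Re ii]
      by (simp add: char_def integral_distr Re_exp)
    then have ec: "expectation (\<lambda>w. cos (\<theta> n * Y w)) = exp (- ((\<theta> n)\<^sup>2 * v) / 2)"
      by (simp add: char)
    have iu: "integrable M (u n)"
      unfolding u_def using ic by auto
    have "(\<integral>\<^sup>+ w. ennreal (u n w) \<partial>M) = ennreal (expectation (u n))"
      using iu u_nonneg by (intro nn_integral_eq_integral) auto
    also have "expectation (u n) = 2 * (1 - exp (- ((\<theta> n)\<^sup>2 * v) / 2)) / (\<theta> n)\<^sup>2"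
      unfolding u_def using ic by (simp add: ec prob_space)
    \<comment> \<open>This is 1 - exp (-y) \<le> y at half of
      \<open>(\<theta> n)\<^sup>2 * v\<close>.\<close>
    also have "\<dots> \<le> v"
      using exp_ge_add_one_self[of "- ((\<theta> n)\<^sup>2 * v) / 2"] \<theta>0[of n] by (simp add: field_simps)
    finally show ?thesis by (simp add: ennreal_leI)
  qed
  have lim: "(\<lambda>n. u n w) \<longlonglongrightarrow> (Y w)\<^sup>2" for w
  proof -
    have "((\<lambda>h. sin (Y w * h)) has_real_derivative Y w) (at 0)"
      by (auto intro!: derivative_eq_intros)
    then have "(\<lambda>h. sin (Y w * h) / h) \<midarrow>0\<rightarrow> Y w"
      by (simp add: DERIV_def)
    moreover have "filterlim (\<lambda>n. \<theta> n / 2) (at 0) sequentially"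
    proof -
      have "\<theta> \<longlonglongrightarrow> 0" unfolding \<theta>_def using LIMSEQ_inverse_real_of_nat by (simp add: inverse_eq_divide)
      then have "(\<lambda>n. \<theta> n / 2) \<longlonglongrightarrow> 0" using tendsto_divide[of \<theta> 0 sequentially "\<lambda>_. 2" 2] by simp
      then show ?thesis using \<theta>0 by (auto simp: filterlim_at less_imp_neq[symmetric])
    qed
    ultimately have "(\<lambda>n. sin (Y w * (\<theta> n / 2)) / (\<theta> n / 2)) \<longlonglongrightarrow> Y w"
      by (rule filterlim_compose)
    then have "(\<lambda>n. (sin (Y w * (\<theta> n / 2)) / (\<theta> n / 2))\<^sup>2) \<longlonglongrightarrow> (Y w)\<^sup>2"
      by (rule tendsto_power)
    \<comment> \<open>The half-angle formula identifies the squared difference quotient of the sine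
      at 0 with \<open>u n w\<close>.\<close>
    moreover have "(sin (Y w * (\<theta> n / 2)) / (\<theta> n / 2))\<^sup>2 = u n w" for n
      using cos_double_sin[of "Y w * (\<theta> n / 2)"] \<theta>0[of n]
      by (simp add: u_def field_simps power2_eq_square)
    ultimately show ?thesis by simp
  qed
  have "(\<integral>\<^sup>+ w. ennreal ((Y w)\<^sup>2) \<partial>M) = (\<integral>\<^sup>+ w. liminf (\<lambda>n. ennreal (u n w)) \<partial>M)"
    by (intro nn_integral_cong lim_imp_Liminf[symmetric] tendsto_ennrealI lim) simp
  also have "\<dots> \<le> liminf (\<lambda>n. \<integral>\<^sup>+ w. ennreal (u n w) \<partial>M)"
    unfolding u_def by (intro nn_integral_liminf) measurable
  also have "\<dots> \<le> ennreal v"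
    by (intro Liminf_le) (auto simp: int)
  finally show ?thesis .
qed

text \<open>The elementary inequality \<bar>a\<bar> \<le> 2^k a^2 + 2^(-k) trades weighted second
  moments of the increments for their absolute values. The expected total variation of the sequence
  is then finite, and almost surely the increments are absolutely summable.\<close>

lemma (in prob_space) AE_convergent_of_fast_L2:
  fixes Y :: "nat \<Rightarrow> 'a \<Rightarrow> real"
  assumes [measurable]: "\<And>k. Y k \<in> borel_measurable M"
    and fin: "(\<Sum>k. ennreal (2 ^ k) * (\<integral>\<^sup>+ w. ennreal ((Y (Suc k) w - Y k w)\<^sup>2) \<partial>M)) \<noteq> \<infinity>"
  shows "AE w in M. convergent (\<lambda>k. Y k w)"
proof -
  have le: "ennreal \<bar>a\<bar> \<le> ennreal (2 ^ k) * ennreal (a\<^sup>2) + ennreal ((1/2) ^ k)" for a :: real and k :: nat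
  proof -
    have "\<bar>a\<bar> \<le> 2 ^ k * a\<^sup>2 + (1/2) ^ k"
    proof (cases "\<bar>a\<bar> \<le> (1/2) ^ k")
      case False
      then have "1 \<le> 2 ^ k * \<bar>a\<bar>" by (simp add: field_simps power_one_over)
      then have "1 * \<bar>a\<bar> \<le> (2 ^ k * \<bar>a\<bar>) * \<bar>a\<bar>" by (intro mult_right_mono) auto
      then have "\<bar>a\<bar> \<le> 2 ^ k * a\<^sup>2" by (simp add: power2_eq_square mult.assoc)
      then show ?thesis by (simp add: add_increasing2)
    qed (simp add: add_increasing)
    then have "ennreal \<bar>a\<bar> \<le> ennreal (2 ^ k * a\<^sup>2 + (1/2) ^ k)" by (rule ennreal_leI)
    then show ?thesis by (simp add: ennreal_mult)
  qed
  have "(\<integral>\<^sup>+ w. (\<Sum>k. ennreal \<bar>Y (Suc k) w - Y k w\<bar>) \<partial>M) = (\<Sum>k. \<integral>\<^sup>+ w. ennreal \<bar>Y (Suc k) w - Y k w\<bar> \<partial>M)"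
    by (rule nn_integral_suminf) measurable
  also have "\<dots> \<le> (\<Sum>k. \<integral>\<^sup>+ w. (ennreal (2 ^ k) * ennreal ((Y (Suc k) w - Y k w)\<^sup>2) + ennreal ((1/2) ^ k)) \<partial>M)"
    by (intro suminf_le nn_integral_mono le) auto
  also have "\<dots> = (\<Sum>k. ennreal (2 ^ k) * (\<integral>\<^sup>+ w. ennreal ((Y (Suc k) w - Y k w)\<^sup>2) \<partial>M) + ennreal ((1/2) ^ k))"
    by (intro suminf_cong, subst nn_integral_add) (auto simp: nn_integral_cmult emeasure_space_1)
  also have "\<dots> = (\<Sum>k. ennreal (2 ^ k) * (\<integral>\<^sup>+ w. ennreal ((Y (Suc k) w - Y k w)\<^sup>2) \<partial>M)) + (\<Sum>k. ennreal ((1/2) ^ k))"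
    by (rule suminf_add[symmetric]) auto
  also have "(\<Sum>k. ennreal ((1/2) ^ k)) = ennreal 2"
    using geometric_sums[of "1/2 :: real"] by (intro suminf_ennreal_eq) auto
  finally have "(\<integral>\<^sup>+ w. (\<Sum>k. ennreal \<bar>Y (Suc k) w - Y k w\<bar>) \<partial>M) \<noteq> \<infinity>"
    using fin by (auto simp: top_unique)
  then have "AE w in M. (\<Sum>k. ennreal \<bar>Y (Suc k) w - Y k w\<bar>) \<noteq> \<infinity>"
    by (intro nn_integral_PInf_AE) measurable
  then show ?thesis
  proof eventually_elim
    case (elim w)
    then have "summable (\<lambda>k. \<bar>Y (Suc k) w - Y k w\<bar>)"
      by (intro summable_suminf_not_top) auto
    then have "summable (\<lambda>k. Y (Suc k) w - Y k w)"
      by (rule summable_rabs_cancel)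
    then have "convergent (\<lambda>n. \<Sum>k<n. Y (Suc k) w - Y k w)"
      by (simp add: summable_iff_convergent)
    then have "convergent (\<lambda>n. Y n w - Y 0 w)"
      by (simp add: sum_lessThan_telescope[of "\<lambda>k. Y k w"])
    then have "convergent (\<lambda>n. (Y n w - Y 0 w) + Y 0 w)"
      by (intro convergent_add convergent_const)
    then show ?case by simp
  qed
qed

text \<open>Fatou's lemma for the squared differences transfers distance bounds from the
  approximations to their almost sure limit.\<close>

lemma (in prob_space) L2_dist_limit_le:
  fixes Y :: "nat \<Rightarrow> 'a \<Rightarrow> real"
  assumes [measurable]: "\<And>k. Y k \<in> borel_measurable M" "Z \<in> borel_measurable M"
    and lim: "AE w in M. (\<lambda>k. Y k w) \<longlonglongrightarrow> L w"
  shows "(\<integral>\<^sup>+ w. ennreal ((Z w - L w)\<^sup>2) \<partial>M) \<le> liminf (\<lambda>k. \<integral>\<^sup>+ w. ennreal ((Z w - Y k w)\<^sup>2) \<partial>M)"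
proof -
  have "(\<integral>\<^sup>+ w. ennreal ((Z w - L w)\<^sup>2) \<partial>M) = (\<integral>\<^sup>+ w. liminf (\<lambda>k. ennreal ((Z w - Y k w)\<^sup>2)) \<partial>M)"
    using lim
  proof (intro nn_integral_cong_AE, eventually_elim)
    case (elim w)
    show ?case
      by (intro lim_imp_Liminf[symmetric] tendsto_ennrealI tendsto_intros elim) simp
  qed
  also have "\<dots> \<le> liminf (\<lambda>k. \<integral>\<^sup>+ w. ennreal ((Z w - Y k w)\<^sup>2) \<partial>M)"
    by (intro nn_integral_liminf) measurable
  finally show ?thesis .
qed

lemma (in prob_space) tendsto_char_distr:
  fixes Y :: "nat \<Rightarrow> 'a \<Rightarrow> real"
  assumes [measurable]: "\<And>k. Y k \<in> borel_measurable M" "L \<in> borel_measurable M"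
    and lim: "AE w in M. (\<lambda>k. Y k w) \<longlonglongrightarrow> L w"
  shows "(\<lambda>k. char (distr M borel (Y k)) \<theta>) \<longlonglongrightarrow> char (distr M borel L) \<theta>"
proof -
  have "(\<lambda>k. CLINT w|M. iexp (\<theta> * Y k w)) \<longlonglongrightarrow> (CLINT w|M. iexp (\<theta> * L w))"
  proof (rule integral_dominated_convergence[where w = "\<lambda>_. 1"])
    show "AE w in M. (\<lambda>k. iexp (\<theta> * Y k w)) \<longlonglongrightarrow> iexp (\<theta> * L w)"
      using lim by eventually_elim (intro tendsto_intros)
  qed auto
  then show ?thesis by (simp add: char_def integral_distr)
qed

text \<open>The expanded squared norm of the difference of two smeared paths. Both cross terms are
  kept, so that symmetry of the energy is never invoked, and the formula shows measurability when
  the paths depend on a sample point.\<close>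

definition energy_dist :: "real \<Rightarrow> real \<Rightarrow> real \<Rightarrow> (real \<Rightarrow> real) \<Rightarrow> real \<Rightarrow> real \<Rightarrow> (real \<Rightarrow> real) \<Rightarrow> real" where
  "energy_dist t \<epsilon> \<delta> p \<epsilon>' \<delta>' q =
     enn2real (energy (\<epsilon> + \<epsilon>) \<delta> \<delta> t p p) - enn2real (energy (\<epsilon> + \<epsilon>') \<delta> \<delta>' t p q)
     - enn2real (energy (\<epsilon>' + \<epsilon>) \<delta>' \<delta> t q p) + enn2real (energy (\<epsilon>' + \<epsilon>') \<delta>' \<delta>' t q q)"

text \<open>Linearity identifies the difference almost surely with \<open>W\<close> of the
  difference, whose characteristic function bounds its second moment. An inequality is all that the
  later estimates use.\<close>

lemma isonormal_smear_dist:
  assumes W: "isonormal MW W"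
    and pos: "0 < \<epsilon>" "0 < \<delta>" "0 < \<epsilon>'" "0 < \<delta>'" "0 < t"
    and pq: "p \<in> borel_measurable borel" "q \<in> borel_measurable borel"
  shows "(\<integral>\<^sup>+ w. ennreal ((W (smear \<epsilon> \<delta> t x p) w - W (smear \<epsilon>' \<delta>' t x q) w)\<^sup>2) \<partial>MW)
     \<le> ennreal (energy_dist t \<epsilon> \<delta> p \<epsilon>' \<delta>' q)"
proof -
  interpret prob_space MW using W by (simp add: isonormal_def)
  define f where "f = smear \<epsilon> \<delta> t x p"
  define g where "g = smear \<epsilon>' \<delta>' t x q"
  define k where "k = (\<lambda>r y. 1 * f r y + (- 1) * g r y)"
  have fg: "H_admissible f" "H_admissible g"
    using pos pq by (auto simp: f_def g_def intro: H_admissible_smear)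
  have nn: "\<And>r y. 0 \<le> f r y" "\<And>r y. 0 \<le> g r y" using pos by (auto simp: f_def g_def smear_nonneg)
  have int: "integrable lborel (H_kernel f g)" "integrable lborel (H_kernel g f)"
    using pos pq by (auto simp: f_def g_def intro: integrable_H_kernel_smear)
  note k = H_admissible_diff[OF fg nn int, folded k_def]
  have v: "H_inner k k = energy_dist t \<epsilon> \<delta> p \<epsilon>' \<delta>' q"
    unfolding k(2) energy_dist_def using pos pq by (simp add: f_def g_def integrable_H_kernel_smear)
  have "W k \<in> borel_measurable MW"
    and ch: "\<And>\<theta>. char (distr MW borel (W k)) \<theta> = complex_of_real (exp (- (\<theta>\<^sup>2 * H_inner k k) / 2))"
    using W k(1) by (auto simp: isonormal_def)
  then have "(\<integral>\<^sup>+ w. ennreal ((W k w)\<^sup>2) \<partial>MW) \<le> ennreal (H_inner k k)"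
    by (intro second_moment_le_of_char)
  moreover have lin: "AE w in MW. W k w = 1 * W f w + (- 1) * W g w"
    using W fg unfolding isonormal_def k_def by blast
  have "(\<integral>\<^sup>+ w. ennreal ((W k w)\<^sup>2) \<partial>MW) = (\<integral>\<^sup>+ w. ennreal ((W f w - W g w)\<^sup>2) \<partial>MW)"
    using lin by (intro nn_integral_cong_AE, eventually_elim) simp
  ultimately show ?thesis by (simp add: v f_def g_def)
qed

section \<open>Discretised paths and averaging over the path law\<close>

text \<open>If it failed, bad pairs of indices beyond every \<open>N\<close> would form two
  sequences tending to infinity along which the limit is violated.\<close>

lemma eventually_double_sequence:
  fixes a :: "nat \<Rightarrow> nat \<Rightarrow> 'a::linorder_topology"
  assumes lim: "\<And>u v. filterlim u at_top sequentially \<Longrightarrow> filterlim v at_top sequentially \<Longrightarrow> (\<lambda>j. a (u j) (v j)) \<longlonglongrightarrow> l"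
    and \<eta>: "l < \<eta>"
  shows "\<exists>N. \<forall>n\<ge>N. \<forall>m\<ge>N. a n m < \<eta>"
proof (rule ccontr)
  assume "\<not> ?thesis"
  then have "\<forall>N. \<exists>n m. n \<ge> N \<and> m \<ge> N \<and> \<not> a n m < \<eta>" by blast
  then obtain u v where uv: "\<And>N. u N \<ge> N" "\<And>N. v N \<ge> N" "\<And>N. \<not> a (u N) (v N) < \<eta>" by metis
  have "filterlim u at_top sequentially" "filterlim v at_top sequentially"
    using uv by (auto intro: filterlim_at_top_mono[OF filterlim_ident])
  from order_tendstoD(2)[OF lim[OF this] \<eta>] uv(3) show False by simp
qed

text \<open>Mesh and rounding are both \<open>1 / real (Suc n)\<close>, and the path is coded by a
  list of integers. Lists of integers form a countable type, which is what makes gluing over all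
  codes measurable. Indices beyond the list yield unspecified values, but only at times outside
  those used.\<close>

definition step_path :: "nat \<Rightarrow> int list \<Rightarrow> real \<Rightarrow> real" where
  "step_path n l s = real_of_int (l ! nat \<lfloor>real (Suc n) * s\<rfloor>) / real (Suc n)"

text \<open>On the grid cell of \<open>s\<close> the path is sampled at the right endpoint, so that right-continuity
  suffices for convergence.\<close>

definition samples :: "nat \<Rightarrow> real \<Rightarrow> (real \<Rightarrow> 'x \<Rightarrow> real) \<Rightarrow> 'x \<Rightarrow> int list" where
  "samples n t X \<xi> = map (\<lambda>j. \<lfloor>real (Suc n) * X (real (Suc j) / real (Suc n)) \<xi>\<rfloor>) [0..<Suc (nat \<lfloor>real (Suc n) * t\<rfloor>)]"

lemma borel_measurable_step_path [measurable]: "step_path n l \<in> borel_measurable borel"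
proof -
  have "(\<lambda>s::real. nat \<lfloor>real (Suc n) * s\<rfloor>) \<in> borel \<rightarrow>\<^sub>M count_space UNIV"
    by measurable
  then have "(\<lambda>s. real_of_int (l ! nat \<lfloor>real (Suc n) * s\<rfloor>) / real (Suc n)) \<in> borel_measurable borel"
    by (rule measurable_compose) simp
  then show ?thesis by (simp add: step_path_def[abs_def])
qed

lemma measurable_map_count_space:
  fixes f :: "'i \<Rightarrow> 'a \<Rightarrow> 'b::countable"
  assumes [measurable]: "\<And>i. f i \<in> M \<rightarrow>\<^sub>M count_space UNIV"
  shows "(\<lambda>x. map (\<lambda>i. f i x) is) \<in> M \<rightarrow>\<^sub>M count_space UNIV"
proof (induction "is")
  case (Cons i "is")
  note [measurable] = Cons
  show ?case
    unfolding list.map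
    by (rule measurable_compose_countable[of "\<lambda>l x. f i x # l", OF _ Cons])
       (rule measurable_compose[OF assms], simp)
qed simp

lemma measurable_samples:
  assumes [measurable]: "\<And>s. X s \<in> borel_measurable M"
  shows "samples n t X \<in> M \<rightarrow>\<^sub>M count_space UNIV"
  unfolding samples_def[abs_def] by (rule measurable_map_count_space) measurable

lemma step_path_samples_tendsto:
  assumes s: "0 \<le> s" "s \<le> t" and cont: "continuous (at_right s) (\<lambda>u. X u \<xi>)"
  shows "(\<lambda>n. step_path n (samples n t X \<xi>) s) \<longlonglongrightarrow> X s \<xi>"
proof -
  define \<sigma> where "\<sigma> = (\<lambda>n. (real_of_int \<lfloor>real (Suc n) * s\<rfloor> + 1) / real (Suc n))"
  have eps: "(\<lambda>n. 1 / real (Suc n)) \<longlonglongrightarrow> 0"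
    using LIMSEQ_inverse_real_of_nat by (simp add: inverse_eq_divide)
  \<comment> \<open>The \<open>+ 1\<close> after the floor keeps the sampling time strictly to the
    right of \<open>s\<close>, even at a grid point, as \<open>at_right\<close> demands.\<close>
  have \<sigma>: "s < \<sigma> n" "\<sigma> n \<le> s + 1 / real (Suc n)" for n
  proof -
    have "real (Suc n) * s < real_of_int \<lfloor>real (Suc n) * s\<rfloor> + 1" "real_of_int \<lfloor>real (Suc n) * s\<rfloor> \<le> real (Suc n) * s"
      by linarith+
    then have "s < \<sigma> n" "\<sigma> n \<le> (real (Suc n) * s + 1) / real (Suc n)"
      unfolding \<sigma>_def by (simp add: field_simps, intro divide_right_mono) auto
    moreover have "(real (Suc n) * s + 1) / real (Suc n) = s + 1 / real (Suc n)"
      by (simp add: add_divide_distrib del: of_nat_Suc)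
    ultimately show "s < \<sigma> n" "\<sigma> n \<le> s + 1 / real (Suc n)" by simp_all
  qed
  have "\<sigma> \<longlonglongrightarrow> s"
  proof (rule tendsto_sandwich[of "\<lambda>_. s" _ _ "\<lambda>n. s + 1 / real (Suc n)"])
    show "(\<lambda>n. s + 1 / real (Suc n)) \<longlonglongrightarrow> s" using tendsto_add[OF tendsto_const[of s] eps] by simp
  qed (use \<sigma> in \<open>auto intro!: always_eventually less_imp_le\<close>)
  then have "filterlim \<sigma> (at_right s) sequentially"
    using \<sigma> by (auto simp: filterlim_at intro!: always_eventually less_imp_neq[symmetric])
  then have X: "(\<lambda>n. X (\<sigma> n) \<xi>) \<longlonglongrightarrow> X s \<xi>"
    using cont unfolding continuous_within by (rule filterlim_compose[rotated])
  have eq: "step_path n (samples n t X \<xi>) s = real_of_int \<lfloor>real (Suc n) * X (\<sigma> n) \<xi>\<rfloor> / real (Suc n)" for n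
  proof -
    \<comment> \<open>The extra \<open>Suc\<close> in the list length provides the cell that
      contains \<open>s = t\<close>.\<close>
    have "\<lfloor>real (Suc n) * s\<rfloor> \<le> \<lfloor>real (Suc n) * t\<rfloor>" using s by (intro floor_mono mult_left_mono) auto
    then have i: "nat \<lfloor>real (Suc n) * s\<rfloor> < Suc (nat \<lfloor>real (Suc n) * t\<rfloor>)" by linarith
    have "0 \<le> real (Suc n) * s" using s by simp
    then have "real (Suc (nat \<lfloor>real (Suc n) * s\<rfloor>)) / real (Suc n) = \<sigma> n"
      by (simp add: \<sigma>_def)
    then show ?thesis
      unfolding step_path_def samples_def using i by (simp del: upt_Suc of_nat_Suc)
  qed
  have "(\<lambda>n. X (\<sigma> n) \<xi> - 1 / real (Suc n)) \<longlonglongrightarrow> X s \<xi>"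
    using tendsto_diff[OF X eps] by simp
  then show ?thesis
  proof (rule tendsto_sandwich[rotated 2, OF _ X])
    have b: "X (\<sigma> n) \<xi> - 1 / real (Suc n) \<le> real_of_int \<lfloor>real (Suc n) * X (\<sigma> n) \<xi>\<rfloor> / real (Suc n)"
      "real_of_int \<lfloor>real (Suc n) * X (\<sigma> n) \<xi>\<rfloor> / real (Suc n) \<le> X (\<sigma> n) \<xi>" for n
    proof -
      have *: "z - 1 / N \<le> real_of_int \<lfloor>N * z\<rfloor> / N \<and> real_of_int \<lfloor>N * z\<rfloor> / N \<le> z" if "0 < N" for N z :: real
      proof -
        have "N * z - 1 \<le> real_of_int \<lfloor>N * z\<rfloor>" "real_of_int \<lfloor>N * z\<rfloor> \<le> N * z" by linarith+
        then have "(N * z - 1) / N \<le> real_of_int \<lfloor>N * z\<rfloor> / N" "real_of_int \<lfloor>N * z\<rfloor> / N \<le> N * z / N"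
          using that by (intro divide_right_mono; simp)+
        then show ?thesis using that by (simp add: diff_divide_distrib)
      qed
      show "X (\<sigma> n) \<xi> - 1 / real (Suc n) \<le> real_of_int \<lfloor>real (Suc n) * X (\<sigma> n) \<xi>\<rfloor> / real (Suc n)"
      "real_of_int \<lfloor>real (Suc n) * X (\<sigma> n) \<xi>\<rfloor> / real (Suc n) \<le> X (\<sigma> n) \<xi>" using *[of "real (Suc n)"] by auto
    qed
    show "\<forall>\<^sub>F n in sequentially. X (\<sigma> n) \<xi> - 1 / real (Suc n) \<le> step_path n (samples n t X \<xi>) s"
      "\<forall>\<^sub>F n in sequentially. step_path n (samples n t X \<xi>) s \<le> X (\<sigma> n) \<xi>"
      unfolding eq using b by auto
  qed
qed

lemma borel_measurable_step_path_samples: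
  assumes "\<And>s. X s \<in> borel_measurable M"
  shows "(\<lambda>z. step_path n (samples n t X (snd z)) (fst z)) \<in> borel_measurable (borel \<Otimes>\<^sub>M M)"
proof (rule measurable_compose_countable[of "\<lambda>l z. step_path n l (fst z)"])
  show "(\<lambda>z. samples n t X (snd z)) \<in> borel \<Otimes>\<^sub>M M \<rightarrow>\<^sub>M count_space UNIV"
    by (rule measurable_compose[OF measurable_snd measurable_samples]) fact
qed measurable

lemma borel_measurable_energy:
  assumes P: "(\<lambda>z. P (fst z) (snd z)) \<in> borel_measurable (borel \<Otimes>\<^sub>M M)"
    and Q: "(\<lambda>z. Q (fst z) (snd z)) \<in> borel_measurable (borel \<Otimes>\<^sub>M M)"
  shows "(\<lambda>\<xi>. energy \<epsilon> \<delta> \<delta>' t (\<lambda>s. P s \<xi>) (\<lambda>s. Q s \<xi>)) \<in> borel_measurable M"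
proof -
  have [measurable (raw)]: "(\<lambda>\<omega>. P (f \<omega>) (g \<omega>)) \<in> borel_measurable N" "(\<lambda>\<omega>. Q (f \<omega>) (g \<omega>)) \<in> borel_measurable N"
    if "f \<in> borel_measurable N" "g \<in> N \<rightarrow>\<^sub>M M" for f g and N :: "'c measure"
    using measurable_compose[OF measurable_Pair[OF that] P] measurable_compose[OF measurable_Pair[OF that] Q] by auto
  show ?thesis unfolding energy_def by measurable
qed

section \<open>Finite limits and averages over the path law\<close>

lemma energy0_le:
  assumes t: "0 < t" and [measurable]: "p \<in> borel_measurable borel"
  shows "energy0 t p p \<le> ennreal (64 * t * sqrt t)"
proof (rule LIMSEQ_le_const2)
  show "(\<lambda>k. energy (1 / real (Suc k)) (1 / real (Suc k)) (1 / real (Suc k)) t p p) \<longlonglongrightarrow> energy0 t p p"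
    using LIMSEQ_inverse_real_of_nat t by (intro tendsto_energy) (auto simp: inverse_eq_divide)
  show "\<exists>N. \<forall>k\<ge>N. energy (1 / real (Suc k)) (1 / real (Suc k)) (1 / real (Suc k)) t p p \<le> ennreal (64 * t * sqrt t)"
    using t by (auto intro!: energy_le)
qed

text \<open>\<open>enn2real\<close> sends infinity to 0, so the nested Bochner integrals agree with
  the nonnegative one only because the inner integral is finite at every \<open>s\<close> of the
  interval.\<close>

lemma energy0_eq_LINT:
  assumes t: "0 < t" and [measurable]: "p \<in> borel_measurable borel"
  shows "enn2real (energy0 t p p) = (LINT s:{0..t}|lborel. LINT r:{0..t}|lborel. heat \<bar>s - r\<bar> (p s - p r))"
proof -
  define h where "h = (\<lambda>s. \<integral>\<^sup>+ r. ennreal (indicator {0..t} r * heat \<bar>s - r\<bar> (p s - p r)) \<partial>lborel)"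
  have [measurable]: "h \<in> borel_measurable borel" unfolding h_def by measurable
  have inner: "(LINT r:{0..t}|lborel. heat \<bar>s - r\<bar> (p s - p r)) = enn2real (h s)" for s
    unfolding set_lebesgue_integral_def h_def real_scaleR_def by (rule integral_eq_nn_integral) auto
  have fin: "h s < top" if "s \<in> {0..t}" for s
  proof -
    have "h s \<le> (\<integral>\<^sup>+ r. indicator {0..t} r * ennreal (16 / sqrt \<bar>s - r\<bar>) \<partial>lborel)"
      unfolding h_def
    proof (intro nn_integral_mono)
      fix r
      have "heat \<bar>s - r\<bar> (p s - p r) \<le> 1 / sqrt \<bar>s - r\<bar>" by (rule heat_le_inverse_sqrt) simp
      also have "\<dots> \<le> 16 / sqrt \<bar>s - r\<bar>" by (intro divide_right_mono) auto
      finally show "ennreal (indicator {0..t} r * heat \<bar>s - r\<bar> (p s - p r)) \<le> indicator {0..t} r * ennreal (16 / sqrt \<bar>s - r\<bar>)"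
        by (auto simp: indicator_def ennreal_leI)
    qed
    then show ?thesis using nn_integral_energy_dominator[of t s] t that by (auto simp: le_less_trans)
  qed
  have "(LINT s:{0..t}|lborel. enn2real (h s)) = enn2real (\<integral>\<^sup>+ s. ennreal (indicator {0..t} s * enn2real (h s)) \<partial>lborel)"
    unfolding set_lebesgue_integral_def real_scaleR_def by (rule integral_eq_nn_integral) auto
  also have "(\<integral>\<^sup>+ s. ennreal (indicator {0..t} s * enn2real (h s)) \<partial>lborel) = energy0 t p p"
    unfolding energy0_def
  proof (rule nn_integral_cong)
    fix s
    have "ennreal (indicator {0..t} s * enn2real (h s)) = indicator {0..t} s * h s"
      using fin[of s] by (auto simp: indicator_def)
    also have "\<dots> = (\<integral>\<^sup>+ r. indicator {0..t} s * ennreal (indicator {0..t} r * heat \<bar>s - r\<bar> (p s - p r)) \<partial>lborel)"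
      unfolding h_def by (rule nn_integral_cmult[symmetric]) measurable
    also have "\<dots> = (\<integral>\<^sup>+ r. indicator {0..t} s * indicator {0..t} r * ennreal (heat \<bar>s - r\<bar> (p s - p r)) \<partial>lborel)"
      by (intro nn_integral_cong) (auto simp: indicator_def)
    finally show "ennreal (indicator {0..t} s * enn2real (h s)) = (\<integral>\<^sup>+ r. indicator {0..t} s * indicator {0..t} r * ennreal (heat \<bar>s - r\<bar> (p s - p r)) \<partial>lborel)" .
  qed
  finally show ?thesis by (simp add: inner)
qed

lemma tendsto_enn2real_energy:
  fixes p q :: "nat \<Rightarrow> real \<Rightarrow> real"
  assumes "\<And>k. 0 < \<epsilon> k" "\<And>k. 0 < \<delta> k" "\<And>k. 0 < \<delta>' k" "0 < t"
    "\<epsilon> \<longlonglongrightarrow> 0" "\<delta> \<longlonglongrightarrow> 0" "\<delta>' \<longlonglongrightarrow> 0"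
    "\<And>s. 0 \<le> s \<Longrightarrow> s \<le> t \<Longrightarrow> (\<lambda>k. p k s) \<longlonglongrightarrow> y s"
    "\<And>s. 0 \<le> s \<Longrightarrow> s \<le> t \<Longrightarrow> (\<lambda>k. q k s) \<longlonglongrightarrow> y s"
    "\<And>k. p k \<in> borel_measurable borel" "\<And>k. q k \<in> borel_measurable borel" "y \<in> borel_measurable borel"
  shows "(\<lambda>k. enn2real (energy (\<epsilon> k) (\<delta> k) (\<delta>' k) t (p k) (q k))) \<longlonglongrightarrow> enn2real (energy0 t y y)"
proof (rule tendsto_enn2real)
  show "(\<lambda>k. energy (\<epsilon> k) (\<delta> k) (\<delta>' k) t (p k) (q k)) \<longlonglongrightarrow> ennreal (enn2real (energy0 t y y))"
    using energy0_le[of t y] assms by (subst ennreal_enn2real) (auto intro!: tendsto_energy simp: top_unique le_less_trans)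
qed simp

text \<open>All four energies tend to the same number, since both families approximate the same
  path; their alternating sum therefore vanishes in the limit, pathwise and then in mean.\<close>

lemma (in prob_space) tendsto_mean_energy_dist:
  fixes P Q :: "nat \<Rightarrow> real \<Rightarrow> 'a \<Rightarrow> real"
  assumes pos: "\<And>k. 0 < \<epsilon> k" "\<And>k. 0 < \<delta> k" "\<And>k. 0 < \<epsilon>' k" "\<And>k. 0 < \<delta>' k" and t: "0 < t"
    and lim: "\<epsilon> \<longlonglongrightarrow> 0" "\<delta> \<longlonglongrightarrow> 0" "\<epsilon>' \<longlonglongrightarrow> 0" "\<delta>' \<longlonglongrightarrow> 0"
    and P: "\<And>k. (\<lambda>z. P k (fst z) (snd z)) \<in> borel_measurable (borel \<Otimes>\<^sub>M M)"
    and Q: "\<And>k. (\<lambda>z. Q k (fst z) (snd z)) \<in> borel_measurable (borel \<Otimes>\<^sub>M M)"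
    and Y: "(\<lambda>z. Y (fst z) (snd z)) \<in> borel_measurable (borel \<Otimes>\<^sub>M M)"
    and Plim: "\<And>s \<xi>. 0 \<le> s \<Longrightarrow> s \<le> t \<Longrightarrow> \<xi> \<in> space M \<Longrightarrow> (\<lambda>k. P k s \<xi>) \<longlonglongrightarrow> Y s \<xi>"
    and Qlim: "\<And>s \<xi>. 0 \<le> s \<Longrightarrow> s \<le> t \<Longrightarrow> \<xi> \<in> space M \<Longrightarrow> (\<lambda>k. Q k s \<xi>) \<longlonglongrightarrow> Y s \<xi>"
  shows "(\<lambda>k. \<integral>\<^sup>+ \<xi>. ennreal (energy_dist t (\<epsilon> k) (\<delta> k) (\<lambda>s. P k s \<xi>) (\<epsilon>' k) (\<delta>' k) (\<lambda>s. Q k s \<xi>)) \<partial>M) \<longlonglongrightarrow> 0"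
proof -
  define B where "B = 64 * t * sqrt t"
  have B: "0 \<le> B" using t by (simp add: B_def)
  have le: "enn2real (energy a b c t p q) \<le> B" if "0 < a" "0 < b" "0 < c" for a b c p q
    using energy_le[OF that t] B unfolding B_def by (intro enn2real_leI) auto
  have "(\<lambda>k. \<integral>\<^sup>+ \<xi>. ennreal (energy_dist t (\<epsilon> k) (\<delta> k) (\<lambda>s. P k s \<xi>) (\<epsilon>' k) (\<delta>' k) (\<lambda>s. Q k s \<xi>)) \<partial>M)
      \<longlonglongrightarrow> (\<integral>\<^sup>+ \<xi>. 0 \<partial>M)"
  proof (rule nn_integral_dominated_convergence[where w = "\<lambda>_. ennreal (2 * B)"])
    show "(\<lambda>\<xi>. ennreal (energy_dist t (\<epsilon> k) (\<delta> k) (\<lambda>s. P k s \<xi>) (\<epsilon>' k) (\<delta>' k) (\<lambda>s. Q k s \<xi>))) \<in> borel_measurable M" for k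
    proof -
      note [measurable] = borel_measurable_energy[OF P P] borel_measurable_energy[OF P Q]
        borel_measurable_energy[OF Q P] borel_measurable_energy[OF Q Q]
      show ?thesis unfolding energy_dist_def by measurable
    qed
    show "AE \<xi> in M. ennreal (energy_dist t (\<epsilon> k) (\<delta> k) (\<lambda>s. P k s \<xi>) (\<epsilon>' k) (\<delta>' k) (\<lambda>s. Q k s \<xi>)) \<le> ennreal (2 * B)" for k
    proof (intro AE_I2 ennreal_leI)
      fix \<xi>
      \<comment> \<open>The cross terms are nonnegative and enter with a minus sign, so the two
        diagonal energies alone give the bound.\<close>
      show "energy_dist t (\<epsilon> k) (\<delta> k) (\<lambda>s. P k s \<xi>) (\<epsilon>' k) (\<delta>' k) (\<lambda>s. Q k s \<xi>) \<le> 2 * B"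
        using le[of "\<epsilon> k + \<epsilon> k" "\<delta> k" "\<delta> k" "\<lambda>s. P k s \<xi>" "\<lambda>s. P k s \<xi>"]
          le[of "\<epsilon>' k + \<epsilon>' k" "\<delta>' k" "\<delta>' k" "\<lambda>s. Q k s \<xi>" "\<lambda>s. Q k s \<xi>"] pos[of k]
          enn2real_nonneg[of "energy (\<epsilon> k + \<epsilon>' k) (\<delta> k) (\<delta>' k) t (\<lambda>s. P k s \<xi>) (\<lambda>s. Q k s \<xi>)"]
          enn2real_nonneg[of "energy (\<epsilon>' k + \<epsilon> k) (\<delta>' k) (\<delta> k) t (\<lambda>s. Q k s \<xi>) (\<lambda>s. P k s \<xi>)"]
        unfolding energy_dist_def by linarith
    qed
    show "AE \<xi> in M. (\<lambda>k. ennreal (energy_dist t (\<epsilon> k) (\<delta> k) (\<lambda>s. P k s \<xi>) (\<epsilon>' k) (\<delta>' k) (\<lambda>s. Q k s \<xi>))) \<longlonglongrightarrow> 0"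
    proof (intro AE_I2)
      fix \<xi> assume \<xi>: "\<xi> \<in> space M"
      define V where "V = enn2real (energy0 t (\<lambda>s. Y s \<xi>) (\<lambda>s. Y s \<xi>))"
      have m: "(\<lambda>s. R s \<xi>) \<in> borel_measurable borel" if "(\<lambda>z. R (fst z) (snd z)) \<in> borel_measurable (borel \<Otimes>\<^sub>M M)" for R :: "real \<Rightarrow> 'a \<Rightarrow> real"
        using measurable_compose[OF measurable_Pair2'[OF \<xi>] that] by simp
      have l: "(\<lambda>k. \<epsilon> k + \<epsilon> k) \<longlonglongrightarrow> 0" "(\<lambda>k. \<epsilon> k + \<epsilon>' k) \<longlonglongrightarrow> 0" "(\<lambda>k. \<epsilon>' k + \<epsilon> k) \<longlonglongrightarrow> 0" "(\<lambda>k. \<epsilon>' k + \<epsilon>' k) \<longlonglongrightarrow> 0"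
        using lim by (auto intro: tendsto_add_zero)
      have "(\<lambda>k. energy_dist t (\<epsilon> k) (\<delta> k) (\<lambda>s. P k s \<xi>) (\<epsilon>' k) (\<delta>' k) (\<lambda>s. Q k s \<xi>)) \<longlonglongrightarrow> V - V - V + V"
        unfolding energy_dist_def V_def
        by (intro tendsto_add tendsto_diff tendsto_enn2real_energy add_pos_pos pos t lim l m[OF P] m[OF Q] m[OF Y] Plim Qlim \<xi>)
      then have "(\<lambda>k. ennreal (energy_dist t (\<epsilon> k) (\<delta> k) (\<lambda>s. P k s \<xi>) (\<epsilon>' k) (\<delta>' k) (\<lambda>s. Q k s \<xi>))) \<longlonglongrightarrow> ennreal (V - V - V + V)"
        by (rule tendsto_ennrealI)
      then show "(\<lambda>k. ennreal (energy_dist t (\<epsilon> k) (\<delta> k) (\<lambda>s. P k s \<xi>) (\<epsilon>' k) (\<delta>' k) (\<lambda>s. Q k s \<xi>))) \<longlonglongrightarrow> 0" by simp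
    qed
    show "(\<integral>\<^sup>+ \<xi>. ennreal (2 * B) \<partial>M) < \<infinity>" by (simp add: emeasure_space_1)
  qed simp_all
  then show ?thesis by simp
qed

section \<open>Construction of the limit\<close>

theorem theorem3p1:
  fixes MW :: "'w measure" and MX :: "'x measure"
    and W :: "(real \<Rightarrow> real \<Rightarrow> real) \<Rightarrow> 'w \<Rightarrow> real"
    and X :: "real \<Rightarrow> 'x \<Rightarrow> real"
    and \<alpha> c t x :: real
  assumes W: "isonormal MW W"
    and X: "stable_process MX \<alpha> c X"
    and \<alpha>: "0 < \<alpha>" "\<alpha> \<le> 2" and c: "0 < c"
    and t: "0 < t"
  shows "\<exists>I :: 'w \<times> 'x \<Rightarrow> real.
     I \<in> borel_measurable (MW \<Otimes>\<^sub>M MX)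
     \<and> ((\<lambda>(\<epsilon>, \<delta>). \<integral>\<^sup>+ \<xi>. (\<integral>\<^sup>+ w. ennreal ((W (A_fun \<epsilon> \<delta> t x X \<xi>) w - I (w, \<xi>))^2) \<partial>MW) \<partial>MX)
          \<longlongrightarrow> 0) (at (0, 0) within ({0<..} \<times> {0<..}))
     \<and> (AE \<xi> in MX. \<forall>\<theta>. char (distr MW borel (\<lambda>w. I (w, \<xi>))) \<theta>
          = complex_of_real (exp (- (\<theta>^2 *
              (LINT s:{0..t}|lborel. LINT r:{0..t}|lborel. heat \<bar>s - r\<bar> (X s \<xi> - X r \<xi>))) / 2)))"
proof -
  interpret MW: prob_space MW using W by (simp add: isonormal_def)
  interpret MX: prob_space MX using X by (simp add: stable_process_def)
  have Xm: "X s \<in> borel_measurable MX" for s using X by (simp add: stable_process_def)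
  have Xc: "continuous (at_right s) (\<lambda>u. X u \<xi>)" if "\<xi> \<in> space MX" "0 \<le> s" for s \<xi>
    using X that by (simp add: stable_process_def)

  define P where "P = (\<lambda>n s \<xi>. step_path n (samples n t X \<xi>) s)"
  \<comment> \<open>Right-continuity, and with it joint measurability as a limit of step paths, is
    available only from time 0 on; hence the cut-off.\<close>
  define Y where "Y = (\<lambda>s \<xi>. if s \<in> {0..t} then X s \<xi> else 0)"
  define e where "e = (\<lambda>n. 1 / real (Suc n))"
  define F where "F = (\<lambda>n \<xi>. smear (e n) (e n) t x (\<lambda>s. P n s \<xi>))"
  define V where "V = (\<lambda>\<xi>. enn2real (energy0 t (\<lambda>s. Y s \<xi>) (\<lambda>s. Y s \<xi>)))"

  have e0: "0 < e n" for n by (simp add: e_def)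
  have elim_e: "e \<longlonglongrightarrow> 0" unfolding e_def using LIMSEQ_inverse_real_of_nat by (simp add: inverse_eq_divide)
  have Pm: "(\<lambda>z. P n (fst z) (snd z)) \<in> borel_measurable (borel \<Otimes>\<^sub>M MX)" for n
    unfolding P_def by (rule borel_measurable_step_path_samples) (rule Xm)
  have PY: "(\<lambda>n. P n s \<xi>) \<longlonglongrightarrow> Y s \<xi>" if "0 \<le> s" "s \<le> t" "\<xi> \<in> space MX" for s \<xi>
    unfolding P_def Y_def using that by (auto intro!: step_path_samples_tendsto Xc)
  have Ym: "(\<lambda>z. Y (fst z) (snd z)) \<in> borel_measurable (borel \<Otimes>\<^sub>M MX)"
  proof (rule borel_measurable_LIMSEQ_metric)
    show "(\<lambda>z. indicator {0..t} (fst z) * P n (fst z) (snd z)) \<in> borel_measurable (borel \<Otimes>\<^sub>M MX)" for n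
      using Pm[of n] by measurable
    fix z :: "real \<times> 'x" assume "z \<in> space (borel \<Otimes>\<^sub>M MX)"
    then have \<xi>: "snd z \<in> space MX" by (auto simp: space_pair_measure)
    show "(\<lambda>n. indicator {0..t} (fst z) * P n (fst z) (snd z)) \<longlonglongrightarrow> Y (fst z) (snd z)"
    proof (cases "fst z \<in> {0..t}")
      case True
      then show ?thesis using PY[of "fst z" "snd z"] \<xi> by simp
    qed (auto simp: Y_def)
  qed
  have sec: "(\<lambda>s. R s \<xi>) \<in> borel_measurable borel"
    if "(\<lambda>z. R (fst z) (snd z)) \<in> borel_measurable (borel \<Otimes>\<^sub>M MX)" "\<xi> \<in> space MX" for R :: "real \<Rightarrow> 'x \<Rightarrow> real" and \<xi>
    using measurable_compose[OF measurable_Pair2'[OF that(2)] that(1)] by simp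
  have A: "A_fun \<epsilon> \<delta> t x X \<xi> = smear \<epsilon> \<delta> t x (\<lambda>s. Y s \<xi>)" for \<epsilon> \<delta> \<xi>
    unfolding A_fun_eq_smear by (rule smear_cong) (simp add: Y_def)
  have V: "V \<xi> = (LINT s:{0..t}|lborel. LINT r:{0..t}|lborel. heat \<bar>s - r\<bar> (X s \<xi> - X r \<xi>))" if "\<xi> \<in> space MX" for \<xi>
    unfolding V_def energy0_eq_LINT[OF t sec[OF Ym that]] set_lebesgue_integral_def
    by (intro Bochner_Integration.integral_cong refl) (auto simp: Y_def indicator_def intro!: Bochner_Integration.integral_cong)
  have Wm: "W (smear \<epsilon> \<delta> t x p) \<in> borel_measurable MW"
    and Wchar: "\<And>\<theta>. char (distr MW borel (W (smear \<epsilon> \<delta> t x p))) \<theta> = complex_of_real (exp (- (\<theta>\<^sup>2 * enn2real (energy (\<epsilon> + \<epsilon>) \<delta> \<delta> t p p)) / 2))"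
    if "0 < \<epsilon>" "0 < \<delta>" "p \<in> borel_measurable borel" for \<epsilon> \<delta> p
    using W H_admissible_smear[OF that(1,2) t that(3)] integrable_H_kernel_smear(2)[OF that(1,2,1,2) t that(3,3)]
    by (auto simp: isonormal_def)

  define J where "J = (\<lambda>n z. W (F n (snd z)) (fst z))"
  \<comment> \<open>For each fixed code \<open>l\<close>, \<open>W\<close> is evaluated at one fixed
    function and is measurable in \<open>w\<close>; the countably many codes are then glued along
    \<open>samples\<close>.\<close>
  have Jm: "J n \<in> borel_measurable (MW \<Otimes>\<^sub>M MX)" for n
    unfolding J_def F_def P_def
  proof (rule measurable_compose_countable[of "\<lambda>l z. W (smear (e n) (e n) t x (\<lambda>s. step_path n l s)) (fst z)"])
    show "(\<lambda>z. samples n t X (snd z)) \<in> MW \<Otimes>\<^sub>M MX \<rightarrow>\<^sub>M count_space UNIV"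
      by (rule measurable_compose[OF measurable_snd measurable_samples]) (rule Xm)
    show "(\<lambda>z. W (smear (e n) (e n) t x (\<lambda>s. step_path n l s)) (fst z)) \<in> borel_measurable (MW \<Otimes>\<^sub>M MX)" for l
      using Wm[OF e0 e0, of "step_path n l" n n] by (intro measurable_compose[OF measurable_fst]) simp
  qed

  define d where "d = (\<lambda>n m \<xi>. ennreal (energy_dist t (e n) (e n) (\<lambda>s. P n s \<xi>) (e m) (e m) (\<lambda>s. P m s \<xi>)))"
  have "\<exists>N. \<forall>n\<ge>N. \<forall>m\<ge>N. (\<integral>\<^sup>+ \<xi>. d n m \<xi> \<partial>MX) < \<eta>" if "0 < \<eta>" for \<eta>
  proof (rule eventually_double_sequence[OF _ that])
    fix u v :: "nat \<Rightarrow> nat" assume uv: "filterlim u at_top sequentially" "filterlim v at_top sequentially"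
    show "(\<lambda>j. \<integral>\<^sup>+ \<xi>. d (u j) (v j) \<xi> \<partial>MX) \<longlonglongrightarrow> 0"
      unfolding d_def
      by (rule MX.tendsto_mean_energy_dist[where Y = Y])
        (auto intro: e0 t Pm Ym filterlim_compose[OF elim_e] filterlim_compose[OF PY] uv)
  qed
  \<comment> \<open>The rate \<open>(1/4) ^ k\<close> beats the weight \<open>2 ^ k\<close> of the
    convergence criterion and leaves a summable \<open>(1/2) ^ k\<close>.\<close>
  then have "\<exists>N. \<forall>n\<ge>N. \<forall>m\<ge>N. (\<integral>\<^sup>+ \<xi>. d n m \<xi> \<partial>MX) < ennreal ((1/4) ^ k)" for k :: nat
    by simp
  then obtain N where N: "\<And>k n m. n \<ge> N k \<Longrightarrow> m \<ge> N k \<Longrightarrow> (\<integral>\<^sup>+ \<xi>. d n m \<xi> \<partial>MX) < ennreal ((1/4) ^ k)"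
    by metis
  \<comment> \<open>The partial sum makes \<open>M k\<close> and \<open>M (Suc k)\<close> both at
    least \<open>N k\<close>, as consecutive terms require; the summand \<open>k\<close> forces
    \<open>M\<close> to infinity.\<close>
  define M where "M = (\<lambda>k. k + (\<Sum>i\<le>k. N i))"
  have M: "M k \<ge> k" "M k \<ge> N k" "M (Suc k) \<ge> N k" for k
  proof -
    have "N k \<le> (\<Sum>i\<le>k. N i)" by (rule member_le_sum) auto
    then show "M k \<ge> k" "M k \<ge> N k" "M (Suc k) \<ge> N k" by (auto simp: M_def)
  qed
  have Mlim: "filterlim M at_top sequentially"
    using M(1) by (auto intro: filterlim_at_top_mono[OF filterlim_ident])
  have dm: "d n m \<in> borel_measurable MX" for n m
  proof -
    note [measurable] = borel_measurable_energy[OF Pm Pm]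
    show ?thesis unfolding d_def energy_dist_def by measurable
  qed

  \<comment> \<open>Where the sequence diverges, \<open>lim\<close> is a fixed unspecified value, so
    \<open>I\<close> is measurable on the whole product.\<close>
  define I where "I = (\<lambda>z. lim (\<lambda>k. J (M k) z))"
  have Im: "I \<in> borel_measurable (MW \<Otimes>\<^sub>M MX)"
    unfolding I_def by (intro borel_measurable_lim_metric Jm)

  have "(\<integral>\<^sup>+ \<xi>. (\<Sum>k. ennreal (2 ^ k) * d (M (Suc k)) (M k) \<xi>) \<partial>MX) = (\<Sum>k. ennreal (2 ^ k) * (\<integral>\<^sup>+ \<xi>. d (M (Suc k)) (M k) \<xi> \<partial>MX))"
    using dm by (subst nn_integral_suminf) (auto simp: nn_integral_cmult)
  also have "\<dots> \<le> (\<Sum>k. ennreal (2 ^ k) * ennreal ((1/4) ^ k))"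
    by (intro suminf_le mult_left_mono less_imp_le N M) auto
  also have "\<dots> = (\<Sum>k. ennreal ((1/2) ^ k))"
    by (simp add: power_mult_distrib[symmetric] flip: ennreal_mult)
  also have "\<dots> = ennreal 2"
    using geometric_sums[of "1/2 :: real"] by (intro suminf_ennreal_eq) auto
  finally have "(\<integral>\<^sup>+ \<xi>. (\<Sum>k. ennreal (2 ^ k) * d (M (Suc k)) (M k) \<xi>) \<partial>MX) \<noteq> \<infinity>"
    by (auto simp: top_unique)
  then have fast: "AE \<xi> in MX. (\<Sum>k. ennreal (2 ^ k) * d (M (Suc k)) (M k) \<xi>) \<noteq> \<infinity>"
    using dm by (intro nn_integral_PInf_AE) measurable
  \<comment> \<open>The exceptional set of \<open>w\<close> may depend on \<open>\<xi>\<close>.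
    Membership of \<open>\<xi>\<close> in the space is carried along because measurability of the
    sections is available there.\<close>
  have conv: "AE \<xi> in MX. \<xi> \<in> space MX \<and> (AE w in MW. (\<lambda>k. W (F (M k) \<xi>) w) \<longlonglongrightarrow> I (w, \<xi>))"
    using fast AE_space
  proof eventually_elim
    case (elim \<xi>)
    have Fm: "W (F n \<xi>) \<in> borel_measurable MW" for n
      unfolding F_def by (intro Wm e0 sec[OF Pm elim(2)])
    have "(\<Sum>k. ennreal (2 ^ k) * (\<integral>\<^sup>+ w. ennreal ((W (F (M (Suc k)) \<xi>) w - W (F (M k) \<xi>) w)\<^sup>2) \<partial>MW))
       \<le> (\<Sum>k. ennreal (2 ^ k) * d (M (Suc k)) (M k) \<xi>)"
      unfolding F_def d_def using isonormal_smear_dist[OF W e0 e0 e0 e0 t sec[OF Pm elim(2)] sec[OF Pm elim(2)]]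
      by (intro suminf_le mult_left_mono) auto
    then have "AE w in MW. convergent (\<lambda>k. W (F (M k) \<xi>) w)"
      using elim(1) Fm by (intro MW.AE_convergent_of_fast_L2) (auto simp: top_unique)
    then have "AE w in MW. (\<lambda>k. W (F (M k) \<xi>) w) \<longlonglongrightarrow> I (w, \<xi>)"
      by eventually_elim (simp add: I_def J_def convergent_LIMSEQ_iff)
    then show ?case using elim by simp
  qed

  have L2: "((\<lambda>(\<epsilon>, \<delta>). \<integral>\<^sup>+ \<xi>. (\<integral>\<^sup>+ w. ennreal ((W (A_fun \<epsilon> \<delta> t x X \<xi>) w - I (w, \<xi>))^2) \<partial>MW) \<partial>MX)
          \<longlongrightarrow> 0) (at (0, 0) within ({0<..} \<times> {0<..}))"
    unfolding tendsto_at_iff_sequentially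
  proof (intro allI impI)
    fix z :: "nat \<Rightarrow> real \<times> real"
    assume z: "\<forall>i. z i \<in> {0<..} \<times> {0<..} - {(0, 0)}" and zlim: "z \<longlonglongrightarrow> (0, 0)"
    define a b where "a = (\<lambda>i. fst (z i))" and "b = (\<lambda>i. snd (z i))"
    have ab: "0 < a i" "0 < b i" for i using z by (auto simp: a_def b_def mem_Times_iff)
    have ablim: "a \<longlonglongrightarrow> 0" "b \<longlonglongrightarrow> 0" using tendsto_fst[OF zlim] tendsto_snd[OF zlim] by (auto simp: a_def b_def)
    define D where "D = (\<lambda>i m \<xi>. ennreal (energy_dist t (a i) (b i) (\<lambda>s. Y s \<xi>) (e m) (e m) (\<lambda>s. P m s \<xi>)))"
    have Dm: "D i m \<in> borel_measurable MX" for i m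
    proof -
      note [measurable] = borel_measurable_energy[OF Ym Ym] borel_measurable_energy[OF Ym Pm]
        borel_measurable_energy[OF Pm Ym] borel_measurable_energy[OF Pm Pm]
      show ?thesis unfolding D_def energy_dist_def by measurable
    qed
    define E where "E = (\<lambda>i. \<integral>\<^sup>+ \<xi>. (\<integral>\<^sup>+ w. ennreal ((W (A_fun (a i) (b i) t x X \<xi>) w - I (w, \<xi>))\<^sup>2) \<partial>MW) \<partial>MX)"
    have "E \<longlonglongrightarrow> 0"
    proof (rule order_tendstoI)
      fix \<eta> :: ennreal assume "0 < \<eta>"
      \<comment> \<open>The limit inferior preserves only non-strict bounds, so a smaller threshold
        is fixed in advance.\<close>
      then obtain \<eta>' where \<eta>': "0 < \<eta>'" "\<eta>' < \<eta>" using dense by blast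
      have "\<exists>N. \<forall>i\<ge>N. \<forall>m\<ge>N. (\<integral>\<^sup>+ \<xi>. D i m \<xi> \<partial>MX) < \<eta>'"
      proof (rule eventually_double_sequence[OF _ \<eta>'(1)])
        fix u v :: "nat \<Rightarrow> nat" assume uv: "filterlim u at_top sequentially" "filterlim v at_top sequentially"
        show "(\<lambda>j. \<integral>\<^sup>+ \<xi>. D (u j) (v j) \<xi> \<partial>MX) \<longlonglongrightarrow> 0"
          unfolding D_def
          by (rule MX.tendsto_mean_energy_dist[where Y = Y])
            (auto intro: e0 ab t Pm Ym filterlim_compose[OF elim_e] filterlim_compose[OF PY]
              filterlim_compose[OF ablim(1)] filterlim_compose[OF ablim(2)] uv)
      qed
      then obtain K where K: "\<And>i m. i \<ge> K \<Longrightarrow> m \<ge> K \<Longrightarrow> (\<integral>\<^sup>+ \<xi>. D i m \<xi> \<partial>MX) < \<eta>'" by blast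
      have "E i \<le> \<eta>'" if i: "i \<ge> K" for i
      proof -
        \<comment> \<open>Monotonicity is applied at almost every \<open>\<xi>\<close>, as the inner
          distance is not known to depend measurably on \<open>\<xi>\<close>. On the right stand
          measurable energies, to which Fatou's lemma applies a second time.\<close>
        have "E i \<le> (\<integral>\<^sup>+ \<xi>. liminf (\<lambda>k. D i (M k) \<xi>) \<partial>MX)"
          unfolding E_def
        proof (rule nn_integral_mono_AE)
          show "AE \<xi> in MX. (\<integral>\<^sup>+ w. ennreal ((W (A_fun (a i) (b i) t x X \<xi>) w - I (w, \<xi>))\<^sup>2) \<partial>MW) \<le> liminf (\<lambda>k. D i (M k) \<xi>)"
            using conv
          proof eventually_elim
            case (elim \<xi>)
            have Fm: "W (F n \<xi>) \<in> borel_measurable MW" for n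
              unfolding F_def using elim by (intro Wm e0 sec[OF Pm]) auto
            have Am: "W (A_fun (a i) (b i) t x X \<xi>) \<in> borel_measurable MW"
              unfolding A using elim by (intro Wm ab sec[OF Ym]) auto
            have "(\<integral>\<^sup>+ w. ennreal ((W (A_fun (a i) (b i) t x X \<xi>) w - I (w, \<xi>))\<^sup>2) \<partial>MW)
              \<le> liminf (\<lambda>k. \<integral>\<^sup>+ w. ennreal ((W (A_fun (a i) (b i) t x X \<xi>) w - W (F (M k) \<xi>) w)\<^sup>2) \<partial>MW)"
              using elim by (intro MW.L2_dist_limit_le Fm Am) auto
            also have "\<dots> \<le> liminf (\<lambda>k. D i (M k) \<xi>)"
              unfolding A F_def D_def using elim
              by (intro Liminf_mono always_eventually allI isonormal_smear_dist[OF W] ab e0 t sec[OF Pm] sec[OF Ym]) auto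
            finally show ?case .
          qed
        qed
        also have "\<dots> \<le> liminf (\<lambda>k. \<integral>\<^sup>+ \<xi>. D i (M k) \<xi> \<partial>MX)"
          by (rule nn_integral_liminf) (rule Dm)
        also have "\<dots> \<le> \<eta>'"
        proof (rule Liminf_le)
          have "eventually (\<lambda>k. K \<le> M k) sequentially" using Mlim by (simp add: filterlim_at_top)
          then show "eventually (\<lambda>k. (\<integral>\<^sup>+ \<xi>. D i (M k) \<xi> \<partial>MX) \<le> \<eta>') sequentially"
            by eventually_elim (rule less_imp_le[OF K[OF i]])
        qed simp
        finally show ?thesis .
      qed
      then show "eventually (\<lambda>i. E i < \<eta>) sequentially"
        using \<eta>'(2) by (auto simp: eventually_sequentially intro: le_less_trans)
    qed simp
    moreover have "(\<lambda>(\<epsilon>, \<delta>). \<integral>\<^sup>+ \<xi>. (\<integral>\<^sup>+ w. ennreal ((W (A_fun \<epsilon> \<delta> t x X \<xi>) w - I (w, \<xi>))^2) \<partial>MW) \<partial>MX) \<circ> z = E"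
      by (simp add: E_def a_def b_def fun_eq_iff split_beta')
    ultimately show "((\<lambda>(\<epsilon>, \<delta>). \<integral>\<^sup>+ \<xi>. (\<integral>\<^sup>+ w. ennreal ((W (A_fun \<epsilon> \<delta> t x X \<xi>) w - I (w, \<xi>))^2) \<partial>MW) \<partial>MX) \<circ> z) \<longlonglongrightarrow> 0"
      by simp
  qed

  have "AE \<xi> in MX. \<forall>\<theta>. char (distr MW borel (\<lambda>w. I (w, \<xi>))) \<theta>
          = complex_of_real (exp (- (\<theta>^2 *
              (LINT s:{0..t}|lborel. LINT r:{0..t}|lborel. heat \<bar>s - r\<bar> (X s \<xi> - X r \<xi>))) / 2))"
    using conv
  proof eventually_elim
    case (elim \<xi>)
    then have \<xi>: "\<xi> \<in> space MX" by simp
    have Fm: "W (F n \<xi>) \<in> borel_measurable MW" for n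
      unfolding F_def by (intro Wm e0 sec[OF Pm \<xi>])
    have Lm: "(\<lambda>w. I (w, \<xi>)) \<in> borel_measurable MW"
      using measurable_compose[OF measurable_Pair2'[OF \<xi>] Im] by simp
    show ?case
    proof
      fix \<theta>
      \<comment> \<open>One sequence of characteristic functions is evaluated in two ways: by almost
        sure convergence of the variables and by convergence of their variances.\<close>
      have "(\<lambda>k. char (distr MW borel (W (F (M k) \<xi>))) \<theta>) \<longlonglongrightarrow> char (distr MW borel (\<lambda>w. I (w, \<xi>))) \<theta>"
        using elim by (intro MW.tendsto_char_distr Fm Lm) auto
      moreover have "(\<lambda>k. char (distr MW borel (W (F (M k) \<xi>))) \<theta>) \<longlonglongrightarrow> complex_of_real (exp (- (\<theta>\<^sup>2 * V \<xi>) / 2))"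
      proof -
        have eM: "(\<lambda>k. e (M k)) \<longlonglongrightarrow> 0" by (rule filterlim_compose[OF elim_e Mlim])
        have "(\<lambda>k. enn2real (energy (e (M k) + e (M k)) (e (M k)) (e (M k)) t (\<lambda>s. P (M k) s \<xi>) (\<lambda>s. P (M k) s \<xi>))) \<longlonglongrightarrow> V \<xi>"
          unfolding V_def
          by (intro tendsto_enn2real_energy add_pos_pos e0 t tendsto_add_zero eM filterlim_compose[OF PY Mlim] \<xi> sec[OF Pm] sec[OF Ym])
        then show ?thesis
          unfolding F_def using sec[OF Pm \<xi>] by (subst Wchar) (auto intro!: e0 tendsto_intros)
      qed
      ultimately have "char (distr MW borel (\<lambda>w. I (w, \<xi>))) \<theta> = complex_of_real (exp (- (\<theta>\<^sup>2 * V \<xi>) / 2))"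
        by (rule LIMSEQ_unique)
      then show "char (distr MW borel (\<lambda>w. I (w, \<xi>))) \<theta> = complex_of_real (exp (- (\<theta>^2 *
              (LINT s:{0..t}|lborel. LINT r:{0..t}|lborel. heat \<bar>s - r\<bar> (X s \<xi> - X r \<xi>))) / 2))"
        by (simp add: V[OF \<xi>])
    qed
  qed
  with Im L2 show ?thesis by blast
qed

end
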